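(* Let $b\ge 3$ and define $\Phi: D_b\to {\rm Z}^1(G_b,\mathbb{R}^2_1)$ by $$\Phi(\alpha,\beta,\mathbf t)=\mathbf u_0^{\alpha,\beta}+\sum_{k=1}^{b-2}t_k\,{\rm AT}_k .$$ Then $\Phi$ descends to a linear isomorphism $\widetilde\Phi: D_b\to {\rm H}^1(G_b,\mathbb{R}^2_1)$, $\widetilde\Phi(\alpha,\beta,\mathbf t)=[\Phi(\alpha,\beta,\mathbf t)]$. In particular $D_b$ and ${\rm H}^1(G_b,\mathbb{R}^2_1)$ are (canonically) isomorphic.
   Context: Lorentzian space: $\mathbb{R}^2_1$ is $\mathbb{R}^3$ with the inner product $B(\mathbf x,\mathbf y)=x_1y_1+x_2y_2-x_3y_3$; $SO^0(2,1)\cong {\rm PSL}(2,\mathbb{R})$ is the identity component of its isometry group. A hyperbolic $g\in SO^0(2,1)$ is an element with three distinct eigenvalues $\lambda_g<1<\lambda_g^{-1}$ ($0<\lambda_g<1$). Its normalized eigenvectors are: $\mathbf X_g^-$ (eigenvalue $\lambda_g$) and $\mathbf X_g^+$ (eigenvalue $\lambda_g^{-1}$), null, future-pointing and of Euclidean length $1$; $\mathbf X_g^0$ (eigenvalue $1$) with $B(\mathbf X_g^0,\mathbf X_g^0)=1$ and $\det(\mathbf X_g^0,\mathbf X_g^-,\mathbf X_g^+)>0$. Group: for $b\ge 3$, $S_{b+1}$ is a sphere with $b+1$ boundary components. Fix a discrete faithful representation $\pi_1(S_{b+1})\to {\rm PSL}(2,\mathbb{R})\cong SO^0(2,1)$ with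 image $G_b$ such that $\mathbb{H}^2/G_b\cong S_{b+1}$ and all peripheral curves are sent to hyperbolic elements. Write $G_b=\langle g_1,\dots,g_{b+1}\mid g_1g_2\cdots g_{b+1}=id\rangle$ (free of rank $b$), each $g_i$ corresponding to a boundary component, with $B(\mathbf X^0_{g_m},\mathbf X^0_{g_n})<-1$ and $B(\mathbf X^0_{g_m},\mathbf X^{\pm}_{g_n})<0$ for $m\ne n$. Put $\mathbb{I}=\{1,\dots,b+1\}$, $\mathbb{J}=\{1,\dots,b-2\}$, and $h_j=g_{j+1}^{-1}g_j^{-1}\cdots g_1^{-1}$ for $j\in\mathbb{J}$ (the dividing curves of a pants decomposition). The pants subgroups are $P_1=\langle g_1,g_2,h_1\rangle$, $P_j=\langle h_{j-1},g_{j+1},h_j\rangle$ for $2\le j\le b-2$, and $P_{b-1}=\langle h_{b-2},g_b,g_{b+1}\rangle$. Write $\mathbf X_i^{0,\pm}=\mathbf X_{g_i}^{0,\pm}$ and $\mathbf Y_j^{0}=\mathbf X_{h_j}^{0}$. Cocycles: a cocycle is a map $\mathbf u:G_b\to\mathbb{R}^2_1$ with $\mathbf u(gh)=g\mathbf u(h)+\mathbf u(g)$; ${\rm Z}^1(G_b,\mathbb{R}^2_1)$ is the space of cocycles. For $\mathbf v\in\mathbb{R}^2_1$ the coboundary is $\delta_{\mathbf v}(g)=\mathbf v-g\mathbf v$; ${\rm H}^1(G_b,\mathbb{R}^2_1)$ is the quotient of ${\rm Z}^1(G_b,\mathbb{R}^2_1)$ by coboundaries. The Margulis invariant of a hyperbolic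 $g$ with respect to $\mathbf u$ is $\alpha_{\mathbf u}(g)=B(\mathbf u(g),\mathbf X_g^0)$. Parameter space: $D_b=\{(\alpha,\beta,\mathbf t)\mid \alpha\in\mathbb{R}^{\mathbb I},\ \beta,\mathbf t\in\mathbb{R}^{\mathbb J}\}\cong\mathbb{R}^{3b-3}$. The cocycle $\mathbf u_0^{\alpha,\beta}$: it is constructed successively on $P_1,P_2,\dots,P_{b-1}$, and is the unique cocycle $\mathbf u$ on $G_b$ such that $\alpha_{\mathbf u}(g_i)=\alpha_i$ for $i\in\mathbb I$, $\alpha_{\mathbf u}(h_j)=\beta_j$ for $j\in\mathbb J$, and, writing $\mathbf u(g_i)=\alpha_i\mathbf X_i^0+c_i^-\mathbf X_i^-+c_i^+\mathbf X_i^+$, one has $c_1^-=c_1^+=0$ and $c_i^-=0$ for $2\le i\le b$. The affine twist ${\rm AT}_k$ ($k\in\mathbb J$) is the cocycle on $G_b$ determined by ${\rm AT}_k|_{P_l}=\mathbf 0$ for $1\le l\le k$ and ${\rm AT}_k|_{P_m}=\delta_{\mathbf Y_k^0}|_{P_m}$ for $k+1\le m\le b-1$. *)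

theory Defs
  imports "HOL-Analysis.Analysis" "HOL-Algebra.Generated_Groups"
begin

section \<open>Lorentzian space and its isometries\<close>

definition lor :: "real^3 \<Rightarrow> real^3 \<Rightarrow> real" where
  "lor x y = x$1 * y$1 + x$2 * y$2 - x$3 * y$3"

definition O21 :: "(real^3^3) set" where
  "O21 = {A. \<forall>x y. lor (A *v x) (A *v y) = lor x y}"

definition SO21 :: "(real^3^3) monoid" where
  "SO21 = \<lparr>carrier = connected_component_set O21 (mat 1), mult = (**), one = mat 1\<rparr>"

definition mprod :: "(real^3^3) list \<Rightarrow> real^3^3" where
  "mprod As = foldr (**) As (mat 1)"

text \<open>The hyperboloid model: the subspace topology it inherits is the topology of the
  hyperbolic plane, and the isometries act by matrix multiplication.\<close>

definition H2 :: "(real^3) set" where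
  "H2 = {x. lor x x = -1 \<and> x$3 > 0}"

definition eigval :: "real^3^3 \<Rightarrow> real \<Rightarrow> bool" where
  "eigval A l \<longleftrightarrow> (\<exists>v. v \<noteq> 0 \<and> A *v v = l *\<^sub>R v)"

definition hyperbolic :: "real^3^3 \<Rightarrow> bool" where
  "hyperbolic A \<longleftrightarrow> A \<in> carrier SO21 \<and>
     (\<exists>l. 0 < l \<and> l < 1 \<and> {e. eigval A e} = {l, 1, 1 / l})"

definition eig :: "real^3^3 \<Rightarrow> real" where
  "eig A = (THE l. 0 < l \<and> l < 1 \<and> eigval A l)"

definition null_eigvec :: "real^3^3 \<Rightarrow> real \<Rightarrow> real^3 \<Rightarrow> bool" where
  "null_eigvec A l v \<longleftrightarrow> A *v v = l *\<^sub>R v \<and> lor v v = 0 \<and> v$3 > 0 \<and> norm v = 1"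

definition Xm :: "real^3^3 \<Rightarrow> real^3" where
  "Xm A = (THE v. null_eigvec A (eig A) v)"

definition Xp :: "real^3^3 \<Rightarrow> real^3" where
  "Xp A = (THE v. null_eigvec A (1 / eig A) v)"

definition X0 :: "real^3^3 \<Rightarrow> real^3" where
  "X0 A = (THE v. A *v v = v \<and> lor v v = 1 \<and>
     det (vector [v, Xm A, Xp A] :: real^3^3) > 0)"

section \<open>The sphere with boundary components and its holonomy group\<close>

definition cap :: "real^3 \<Rightarrow> real \<Rightarrow> (real^3) set" where
  "cap c r = sphere 0 1 \<inter> cball c r"

definition disjoint_caps :: "nat \<Rightarrow> (nat \<Rightarrow> real^3) \<Rightarrow> (nat \<Rightarrow> real) \<Rightarrow> bool" where
  "disjoint_caps n c r \<longleftrightarrow>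
     (\<forall>i\<in>{1..n}. norm (c i) = 1 \<and> 0 < r i) \<and>
     (\<forall>i\<in>{1..n}. \<forall>j\<in>{1..n}. i \<noteq> j \<longrightarrow> cap (c i) (r i) \<inter> cap (c j) (r j) = {})"

text \<open>The interior of the surface with \<open>n\<close> boundary components obtained from the unit sphere by
  removing \<open>n\<close> open caps. A complete hyperbolic surface has no boundary, so it is this interior that
  the quotient of the hyperbolic plane is homeomorphic to.\<close>

definition holed_sphere :: "nat \<Rightarrow> (nat \<Rightarrow> real^3) \<Rightarrow> (nat \<Rightarrow> real) \<Rightarrow> (real^3) set" where
  "holed_sphere n c r = sphere 0 1 - (\<Union>i\<in>{1..n}. cap (c i) (r i))"

text \<open>A homeomorphism from the orbit space of \<open>G\<close> onto \<open>S\<close>, given as a map on the hyperbolic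
  plane.\<close>

definition orbit_homeo :: "(real^3^3) set \<Rightarrow> (real^3) set \<Rightarrow> (real^3 \<Rightarrow> real^3) \<Rightarrow> bool" where
  "orbit_homeo G S p \<longleftrightarrow>
     quotient_map (top_of_set H2) (top_of_set S) p \<and>
     (\<forall>x\<in>H2. \<forall>y\<in>H2. p x = p y \<longleftrightarrow> (\<exists>A\<in>G. y = A *v x))"

text \<open>Free homotopy classes of loops in the quotient correspond to conjugacy classes in \<open>G\<close>: a loop
  represents the class of \<open>A\<close> iff it is the image of a path in the hyperbolic plane from some
  point \<open>x\<close> to \<open>A *v x\<close>. So the following says that the class of \<open>A\<close> can be freely homotoped into
  every collar of the boundary circle around the cap with centre \<open>c\<close> and radius \<open>r\<close>. This includes
  the trivial class and all powers of the boundary curve.\<close>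

definition homotopic_into_boundary ::
    "(real^3 \<Rightarrow> real^3) \<Rightarrow> real^3 \<Rightarrow> real \<Rightarrow> real^3^3 \<Rightarrow> bool" where
  "homotopic_into_boundary p c r A \<longleftrightarrow>
     (\<forall>e>0. \<exists>\<gamma>. path \<gamma> \<and> path_image \<gamma> \<subseteq> H2 \<and> pathfinish \<gamma> = A *v pathstart \<gamma> \<and>
        p ` path_image \<gamma> \<subseteq> cball c (r + e))"

text \<open>Words in letters \<open>(i, True)\<close> for \<open>g i\<close> and \<open>(i, False)\<close> for its inverse.\<close>

definition word_val :: "(nat \<Rightarrow> real^3^3) \<Rightarrow> (nat \<times> bool) list \<Rightarrow> real^3^3" where
  "word_val g w = mprod (map (\<lambda>(i, s). if s then g i else matrix_inv (g i)) w)"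

definition reduced :: "(nat \<times> bool) list \<Rightarrow> bool" where
  "reduced w \<longleftrightarrow> successively (\<lambda>x y. \<not> (fst x = fst y \<and> snd x \<noteq> snd y)) w"

definition freely_independent :: "nat set \<Rightarrow> (nat \<Rightarrow> real^3^3) \<Rightarrow> bool" where
  "freely_independent J g \<longleftrightarrow>
     (\<forall>w. w \<noteq> [] \<and> fst ` set w \<subseteq> J \<and> reduced w \<longrightarrow> word_val g w \<noteq> mat 1)"

definition Gb :: "nat \<Rightarrow> (nat \<Rightarrow> real^3^3) \<Rightarrow> (real^3^3) set" where
  "Gb b g = generate SO21 (g ` {1..b+1})"

text \<open>The presentation with generators \<open>g 1, ..., g (b+1)\<close> and the single relator
  \<open>g 1 ** ... ** g (b+1)\<close> is expressed by that relation together with freeness on the first \<open>b\<close>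
  generators. The \<open>i\<close>-th generator belongs to the \<open>i\<close>-th boundary component; being part of a free
  basis it is no proper power, so it represents a boundary curve traversed once.\<close>

definition holonomy_generators :: "nat \<Rightarrow> (nat \<Rightarrow> real^3^3) \<Rightarrow> bool" where
  "holonomy_generators b g \<longleftrightarrow>
     g ` {1..b+1} \<subseteq> carrier SO21 \<and>
     discrete (Gb b g) \<and>
     mprod (map g [1..<b+2]) = mat 1 \<and>
     freely_independent {1..b} g \<and>
     (\<exists>c r p. disjoint_caps (b+1) c r \<and>
        orbit_homeo (Gb b g) (holed_sphere (b+1) c r) p \<and>
        (\<forall>A\<in>Gb b g. \<forall>i\<in>{1..b+1}. A \<noteq> mat 1 \<and> homotopic_into_boundary p (c i) (r i) A
            \<longrightarrow> hyperbolic A) \<and>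
        (\<forall>i\<in>{1..b+1}. homotopic_into_boundary p (c i) (r i) (g i))) \<and>
     (\<forall>m\<in>{1..b+1}. \<forall>n\<in>{1..b+1}. m \<noteq> n \<longrightarrow>
        lor (X0 (g m)) (X0 (g n)) < -1 \<and>
        lor (X0 (g m)) (Xp (g n)) < 0 \<and>
        lor (X0 (g m)) (Xm (g n)) < 0)"

definition hcurve :: "(nat \<Rightarrow> real^3^3) \<Rightarrow> nat \<Rightarrow> real^3^3" where
  "hcurve g j = mprod (map (\<lambda>i. matrix_inv (g i)) (rev [1..<j+2]))"

definition pants :: "nat \<Rightarrow> (nat \<Rightarrow> real^3^3) \<Rightarrow> nat \<Rightarrow> (real^3^3) set" where
  "pants b g j = generate SO21
     (if j = 1 then {g 1, g 2, hcurve g 1}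
      else if j = b - 1 then {hcurve g (b - 2), g b, g (b + 1)}
      else {hcurve g (j - 1), g (j + 1), hcurve g j})"

section \<open>Cocycles and cohomology\<close>

text \<open>A map on \<open>G\<close> is represented by its extension by zero, so that pointwise operations on
  functions are the vector space operations on cocycles.\<close>

definition Z1 :: "(real^3^3) set \<Rightarrow> (real^3^3 \<Rightarrow> real^3) set" where
  "Z1 G = {u. (\<forall>A\<in>G. \<forall>B\<in>G. u (A ** B) = A *v u B + u A) \<and> (\<forall>A. A \<notin> G \<longrightarrow> u A = 0)}"

definition coboundary :: "(real^3^3) set \<Rightarrow> real^3 \<Rightarrow> (real^3^3 \<Rightarrow> real^3)" where
  "coboundary G v = (\<lambda>A. if A \<in> G then v - A *v v else 0)"

definition cohom_class :: "(real^3^3) set \<Rightarrow> (real^3^3 \<Rightarrow> real^3) \<Rightarrow> (real^3^3 \<Rightarrow> real^3) set" where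
  "cohom_class G u = {w \<in> Z1 G. \<exists>v. (\<lambda>A. w A - u A) = coboundary G v}"

definition H1 :: "(real^3^3) set \<Rightarrow> (real^3^3 \<Rightarrow> real^3) set set" where
  "H1 G = cohom_class G ` Z1 G"

definition H1_add where
  "H1_add G P Q = (\<Union>u\<in>P. \<Union>w\<in>Q. cohom_class G (\<lambda>A. u A + w A))"

definition H1_scale where
  "H1_scale G a P = (\<Union>u\<in>P. cohom_class G (\<lambda>A. a *\<^sub>R u A))"

definition margulis :: "(real^3^3 \<Rightarrow> real^3) \<Rightarrow> real^3^3 \<Rightarrow> real" where
  "margulis u A = lor (u A) (X0 A)"

section \<open>The parameter space and the parametrisation\<close>

type_synonym params = "(nat \<Rightarrow> real) \<times> (nat \<Rightarrow> real) \<times> (nat \<Rightarrow> real)"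

text \<open>Families indexed by a finite set \<open>I\<close> are functions on \<open>nat\<close> vanishing outside \<open>I\<close>.\<close>

definition Db :: "nat \<Rightarrow> params set" where
  "Db b = {(\<alpha>, \<beta>, t). (\<forall>i. i \<notin> {1..b+1} \<longrightarrow> \<alpha> i = 0) \<and>
     (\<forall>j. j \<notin> {1..b-2} \<longrightarrow> \<beta> j = 0) \<and> (\<forall>j. j \<notin> {1..b-2} \<longrightarrow> t j = 0)}"

fun params_add :: "params \<Rightarrow> params \<Rightarrow> params" where
  "params_add (\<alpha>, \<beta>, t) (\<alpha>', \<beta>', t') =
     ((\<lambda>i. \<alpha> i + \<alpha>' i), (\<lambda>j. \<beta> j + \<beta>' j), (\<lambda>j. t j + t' j))"

fun params_scale :: "real \<Rightarrow> params \<Rightarrow> params" where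
  "params_scale a (\<alpha>, \<beta>, t) = ((\<lambda>i. a * \<alpha> i), (\<lambda>j. a * \<beta> j), (\<lambda>j. a * t j))"

definition u0 :: "nat \<Rightarrow> (nat \<Rightarrow> real^3^3) \<Rightarrow> (nat \<Rightarrow> real) \<Rightarrow> (nat \<Rightarrow> real) \<Rightarrow>
    (real^3^3 \<Rightarrow> real^3)" where
  "u0 b g \<alpha> \<beta> = (THE u. u \<in> Z1 (Gb b g) \<and>
     (\<forall>i\<in>{1..b+1}. margulis u (g i) = \<alpha> i) \<and>
     (\<forall>j\<in>{1..b-2}. margulis u (hcurve g j) = \<beta> j) \<and>
     (\<exists>cm cp. (\<forall>i\<in>{1..b+1}. u (g i) =
                 \<alpha> i *\<^sub>R X0 (g i) + cm i *\<^sub>R Xm (g i) + cp i *\<^sub>R Xp (g i)) \<and>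
        cm 1 = 0 \<and> cp 1 = 0 \<and> (\<forall>i\<in>{2..b}. cm i = 0)))"

definition AT :: "nat \<Rightarrow> (nat \<Rightarrow> real^3^3) \<Rightarrow> nat \<Rightarrow> (real^3^3 \<Rightarrow> real^3)" where
  "AT b g k = (THE u. u \<in> Z1 (Gb b g) \<and>
     (\<forall>l\<in>{1..k}. \<forall>A\<in>pants b g l. u A = 0) \<and>
     (\<forall>m\<in>{k+1..b-1}. \<forall>A\<in>pants b g m.
        u A = coboundary (Gb b g) (X0 (hcurve g k)) A))"

fun Phi :: "nat \<Rightarrow> (nat \<Rightarrow> real^3^3) \<Rightarrow> params \<Rightarrow> (real^3^3 \<Rightarrow> real^3)" where
  "Phi b g (\<alpha>, \<beta>, t) = (\<lambda>A. u0 b g \<alpha> \<beta> A + (\<Sum>k=1..b-2. t k *\<^sub>R AT b g k A))"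

definition linear_iso_to_H1 ::
    "nat \<Rightarrow> (real^3^3) set \<Rightarrow> (params \<Rightarrow> (real^3^3 \<Rightarrow> real^3) set) \<Rightarrow> bool" where
  "linear_iso_to_H1 b G F \<longleftrightarrow>
     bij_betw F (Db b) (H1 G) \<and>
     (\<forall>x\<in>Db b. \<forall>y\<in>Db b. F (params_add x y) = H1_add G (F x) (F y)) \<and>
     (\<forall>a. \<forall>x\<in>Db b. F (params_scale a x) = H1_scale G a (F x))"

end

theory Submission
  imports Defs
begin

text \<open>
  The group is free on \<open>g 1, \<dots>, g b\<close>, so a cocycle is the same as an arbitrary choice of vectors
  \<open>u (g 1), \<dots>, u (g b)\<close> (\<open>cocycle_exists\<close>). The theorem is then a statement in linear algebra whose
  matrices turn out to be triangular, once certain Lorentz products are known not to vanish.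

  \<^bold>\<open>Linear algebra.\<close> Write \<open>u (g i)\<close> in the eigenframe of \<open>g i\<close>. Call \<open>u\<close> normalised if \<open>u (g 1)\<close> is a
  multiple of \<open>X0 (g 1)\<close> and \<open>u (g i)\<close> has no component along \<open>Xm (g i)\<close> for \<open>2 \<le> i \<le> b\<close>. For a normalised
  cocycle the \<open>X0\<close>-components are the Margulis invariants of the \<open>g i\<close>, and one coefficient, along
  \<open>Xp (g (j + 2))\<close>, remains free for each \<open>0 \<le> j \<le> b - 2\<close>. Put \<open>h 0 = inverse (g 1)\<close>; then
  \<open>h (j + 1) = inverse (g (j + 2)) ** h j\<close> and \<open>h (b - 1) = g (b + 1)\<close>, so the invariant of \<open>h (j + 1)\<close>
  is an affine function of that coefficient, with slope a multiple of the product of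
  \<open>Xp (g (j + 2))\<close> and \<open>X0 (h (j + 1))\<close>. If the slope is non-zero, normalised cocycles correspond
  to the parameters \<open>\<alpha>, \<beta>\<close> (\<open>normalized_exists\<close>, \<open>normalized_zero\<close>). Coboundaries and affine twists have zero
  Margulis invariants. A coboundary can normalise \<open>u\<close> on \<open>g 1\<close> and \<open>g 2\<close>, and the twist along \<open>h k\<close>
  vanishes on \<open>g 1, \<dots>, g (k + 1)\<close> and changes the \<open>Xm\<close>-component on \<open>g (k + 2)\<close> by a multiple of the product
  of \<open>X0 (h k)\<close> and \<open>Xp (g (k + 2))\<close>. So every cocycle is normalised by a unique combination
  of twists, up to a coboundary (\<open>normalize\<close>, \<open>coboundary_eq_twist\<close>).

  \<^bold>\<open>Nondegeneracy.\<close> The products just mentioned vanish only if \<open>h j\<close> and \<open>g (j + 2)\<close> have a common null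
  eigenvector. Then their commutator fixes a null vector, so it is not hyperbolic
  (\<open>no_common_null_eigenvector\<close>).

  \<^bold>\<open>Hyperbolicity.\<close> For this argument, and for the vectors \<open>X0 (h j)\<close> to make sense, the elements \<open>h j\<close>
  and the commutators must be hyperbolic. They have infinite order by freeness, and every element of
  infinite order is hyperbolic (\<open>infinite_order_hyperbolic\<close>). Otherwise it fixes a point of
  the hyperbolic plane, and then its powers accumulate, against discreteness, or it fixes a null
  vector. In the latter case it moves points far out towards that vector arbitrarily little, whereas over a compact
  part of the quotient its displacement is bounded below. So it is represented by loops in
  arbitrarily thin collars of the boundary: it is peripheral (\<open>parabolic_peripheral\<close>), hence
  hyperbolic by assumption.
\<close>

section \<open>Lorentz geometry\<close>

lemma matrix_vector_3: "(A *v x)$i = A$i$1 * x$1 + A$i$2 * x$2 + A$i$3 * x$3" for A :: "real^3^3"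
  by (simp add: matrix_vector_mult_def sum_3)

lemma matrix_vector_minus: "A *v (- x) = - (A *v x)" for A :: "real^3^3"
  by (simp add: vec_eq_iff matrix_vector_3)

lemma lor_add_left: "lor (x + y) z = lor x z + lor y z"
  and lor_add_right: "lor z (x + y) = lor z x + lor z y"
  and lor_diff_left: "lor (x - y) z = lor x z - lor y z"
  and lor_diff_right: "lor z (x - y) = lor z x - lor z y"
  and lor_minus_left: "lor (- x) z = - lor x z"
  and lor_minus_right: "lor z (- x) = - lor z x"
  and lor_scale_left: "lor (a *\<^sub>R x) z = a * lor x z"
  and lor_scale_right: "lor z (a *\<^sub>R x) = a * lor z x"
  and lor_zero_left: "lor 0 z = 0"
  and lor_zero_right: "lor z 0 = 0"
  by (simp_all add: lor_def algebra_simps)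

lemmas lor_bilinear = lor_add_left lor_add_right lor_diff_left lor_diff_right lor_minus_left
  lor_minus_right lor_scale_left lor_scale_right lor_zero_left lor_zero_right

lemma lor_commute: "lor x y = lor y x"
  by (simp add: lor_def)

lemma lor_ext:
  assumes "\<And>y. lor x y = lor z y"
  shows "x = z"
  using assms[of "axis 1 1"] assms[of "axis 2 1"] assms[of "axis 3 1"]
  by (simp add: lor_def vec_eq_iff forall_3 axis_def)

text \<open>The adjoint for the Lorentz product. On the Lorentz group it is a formula for the inverse that is
  visibly continuous.\<close>

definition ladj :: "real^3^3 \<Rightarrow> real^3^3" where
  "ladj A = (\<chi> i j. (if i = 3 then -1 else 1) * (if j = 3 then -1 else 1) * A$j$i)"

lemma lor_ladj: "lor (A *v x) y = lor x (ladj A *v y)"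
  by (simp add: lor_def matrix_vector_3 ladj_def algebra_simps)

lemma ladj_ladj [simp]: "ladj (ladj A) = A"
  by (simp add: ladj_def vec_eq_iff)

lemma ladj_one [simp]: "ladj (mat 1) = mat 1"
  by (simp add: ladj_def vec_eq_iff mat_def)

lemma det_ladj: "det (ladj A) = det A"
  by (simp add: det_3 ladj_def algebra_simps)

lemma O21D: "A \<in> O21 \<Longrightarrow> lor (A *v x) (A *v y) = lor x y"
  by (simp add: O21_def)

lemma ladj_mult_left:
  assumes "A \<in> O21"
  shows "ladj A ** A = mat 1"
  unfolding matrix_eq
proof
  fix x
  have "lor (ladj A *v (A *v x)) y = lor x y" for y
    using lor_ladj[of A y "A *v x"] O21D[OF assms, of y x] by (simp add: lor_commute)
  then show "(ladj A ** A) *v x = mat 1 *v x"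
    by (simp add: lor_ext flip: matrix_vector_mul_assoc)
qed

lemma ladj_mult_right: "A \<in> O21 \<Longrightarrow> A ** ladj A = mat 1"
  using ladj_mult_left matrix_left_right_inverse by blast

lemma ladj_O21:
  assumes "A \<in> O21"
  shows "ladj A \<in> O21"
proof -
  have "lor (ladj A *v x) (ladj A *v y) = lor x y" for x y
    using lor_ladj[of "ladj A" x "ladj A *v y"] ladj_mult_right[OF assms]
    by (simp add: matrix_vector_mul_assoc)
  then show ?thesis by (simp add: O21_def)
qed

lemma matrix_inv_O21:
  assumes "A \<in> O21"
  shows "matrix_inv A = ladj A"
proof -
  have "A ** matrix_inv A = mat 1"
    unfolding matrix_inv_def
    using someI[of "\<lambda>A'. A ** A' = mat 1 \<and> A' ** A = mat 1" "ladj A"]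
      ladj_mult_left[OF assms] ladj_mult_right[OF assms] by auto
  then have "ladj A ** (A ** matrix_inv A) = ladj A" by simp
  then show ?thesis
    by (simp add: matrix_mul_assoc ladj_mult_left[OF assms])
qed

lemma O21_mult: "A \<in> O21 \<Longrightarrow> B \<in> O21 \<Longrightarrow> A ** B \<in> O21"
  by (simp add: O21_def flip: matrix_vector_mul_assoc)

lemma one_O21: "mat 1 \<in> O21"
  by (simp add: O21_def)

lemma ladj_column_3: "ladj A *v axis 3 1 = (\<chi> i. (if i = 3 then 1 else -1) * A$3$i)"
  by (simp add: vec_eq_iff matrix_vector_3 axis_def ladj_def)

lemma O21_row_3: "A \<in> O21 \<Longrightarrow> (A$3$1)\<^sup>2 + (A$3$2)\<^sup>2 = (A$3$3)\<^sup>2 - 1"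
  using O21D[OF ladj_O21, of A "axis 3 1" "axis 3 1"]
  unfolding ladj_column_3 by (simp add: lor_def axis_def power2_eq_square)

lemma O21_columns:
  assumes "A \<in> O21"
  shows "(A$1$1)\<^sup>2 + (A$2$1)\<^sup>2 = (A$3$1)\<^sup>2 + 1"
    and "(A$1$2)\<^sup>2 + (A$2$2)\<^sup>2 = (A$3$2)\<^sup>2 + 1"
    and "(A$1$3)\<^sup>2 + (A$2$3)\<^sup>2 = (A$3$3)\<^sup>2 - 1"
  using O21D[OF assms, of "axis 1 1" "axis 1 1"] O21D[OF assms, of "axis 2 1" "axis 2 1"]
    O21D[OF assms, of "axis 3 1" "axis 3 1"]
  by (simp_all add: lor_def axis_def matrix_vector_3 power2_eq_square)

text \<open>The determinant and the lower right entry of a Lorentz matrix both satisfy \<open>x\<^sup>2 \<ge> 1\<close>, so on the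
  identity component they keep the sign they have at the identity.\<close>

lemma connected_ge_1:
  fixes f :: "'a::topological_space \<Rightarrow> real"
  assumes "connected T" "continuous_on T f" "x \<in> T" "f x = 1" "y \<in> T" "\<And>z. z \<in> T \<Longrightarrow> (f z)\<^sup>2 \<ge> 1"
  shows "f y \<ge> 1"
proof (rule ccontr)
  assume "\<not> f y \<ge> 1"
  moreover have "(f y)\<^sup>2 \<ge> 1" using assms by blast
  moreover have "1 \<le> \<bar>f y\<bar>" using calculation(2) abs_le_square_iff[of 1 "f y"] by simp
  ultimately have "f y \<le> -1" by linarith
  then have "0 \<in> f ` T"
    using connected_contains_Icc[OF connected_continuous_image[OF assms(2,1)], of "f y" "f x"] assms
    by auto
  then show False using assms(6) by fastforce
qed

lemma SO21_carrierD:
  assumes "A \<in> carrier SO21"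
  shows "A \<in> O21" "det A = 1" "A$3$3 \<ge> 1"
proof -
  let ?C = "connected_component_set O21 (mat 1)"
  have A: "A \<in> ?C" using assms by (simp add: SO21_def)
  have C: "connected ?C" "mat 1 \<in> ?C" "?C \<subseteq> O21"
    using connected_component_subset connected_component_refl[OF one_O21]
    by (simp_all add: connected_connected_component)
  show "A \<in> O21" using A C by blast
  have det2: "(det B)\<^sup>2 = 1" if "B \<in> O21" for B
    using ladj_mult_left[OF that] det_mul[of "ladj B" B] by (simp add: det_ladj power2_eq_square)
  have "det A \<ge> 1"
    by (rule connected_ge_1[OF C(1) _ C(2) _ A])
       (use C det2 in \<open>auto simp: det_3 mat_def intro!: continuous_intros\<close>)
  then show "det A = 1" using det2[OF \<open>A \<in> O21\<close>]
    by (simp add: power2_eq_1_iff)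
  have sq: "(B$3$3)\<^sup>2 \<ge> 1" if "B \<in> O21" for B
    using O21_row_3[OF that] by (smt (verit) zero_le_power2)
  show "A$3$3 \<ge> 1"
    by (rule connected_ge_1[OF C(1) _ C(2) _ A])
       (use C sq in \<open>auto simp: mat_def intro!: continuous_intros\<close>)
qed

lemma SO21_mult:
  assumes "A \<in> carrier SO21" "B \<in> carrier SO21"
  shows "A ** B \<in> carrier SO21"
proof -
  obtain T where T: "connected T" "T \<subseteq> O21" "mat 1 \<in> T" "A \<in> T"
    using assms(1) by (auto simp: SO21_def connected_component_def)
  have "connected ((\<lambda>X. X ** B) ` T)"
    by (rule connected_continuous_image[OF _ T(1)])
       (auto simp: matrix_matrix_mult_def intro!: continuous_intros)
  moreover have "(\<lambda>X. X ** B) ` T \<subseteq> O21"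
    using T(2) O21_mult SO21_carrierD(1)[OF assms(2)] by blast
  moreover have "B \<in> (\<lambda>X. X ** B) ` T" using T(3) by force
  ultimately have "connected_component O21 B (A ** B)"
    using T(4) unfolding connected_component_def by blast
  with assms(2) show ?thesis
    by (auto simp: SO21_def intro: connected_component_trans)
qed

lemma SO21_ladj:
  assumes "A \<in> carrier SO21"
  shows "ladj A \<in> carrier SO21"
proof -
  obtain T where T: "connected T" "T \<subseteq> O21" "mat 1 \<in> T" "A \<in> T"
    using assms(1) by (auto simp: SO21_def connected_component_def)
  have "connected (ladj ` T)"
    by (rule connected_continuous_image[OF _ T(1)])
       (auto simp: ladj_def intro!: continuous_intros)
  moreover have "ladj ` T \<subseteq> O21" using T(2) ladj_O21 by blast
  moreover have "mat 1 \<in> ladj ` T" using T(3) by force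
  ultimately show ?thesis
    using T(4) unfolding SO21_def connected_component_def by auto
qed

lemma SO21_one: "mat 1 \<in> carrier SO21"
  by (simp add: SO21_def one_O21)

lemma SO21_mult_eq: "A \<otimes>\<^bsub>SO21\<^esub> B = A ** B" and SO21_one_eq: "\<one>\<^bsub>SO21\<^esub> = mat 1"
  by (simp_all add: SO21_def)

lemma group_SO21: "group SO21"
proof (rule groupI)
  fix x assume "x \<in> carrier SO21"
  then show "\<exists>y\<in>carrier SO21. y \<otimes>\<^bsub>SO21\<^esub> x = \<one>\<^bsub>SO21\<^esub>"
    using SO21_ladj SO21_carrierD(1) ladj_mult_left by (auto simp: SO21_mult_eq SO21_one_eq)
qed (auto simp: SO21_mult_eq SO21_one_eq SO21_mult SO21_one matrix_mul_assoc)

lemma SO21_inv_eq: "A \<in> carrier SO21 \<Longrightarrow> inv\<^bsub>SO21\<^esub> A = matrix_inv A"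
  using group.inv_equality[OF group_SO21, of "ladj A" A] SO21_ladj SO21_carrierD(1)[of A]
  by (simp add: SO21_mult_eq SO21_one_eq ladj_mult_left matrix_inv_O21)

lemma SO21_matrix_inv: "A \<in> carrier SO21 \<Longrightarrow> matrix_inv A \<in> carrier SO21"
  by (simp add: matrix_inv_O21 SO21_carrierD(1) SO21_ladj)

lemma matrix_inv_cancel:
  assumes "A \<in> carrier SO21"
  shows "A ** matrix_inv A = mat 1" "matrix_inv A ** A = mat 1"
    "A *v (matrix_inv A *v x) = x" "matrix_inv A *v (A *v x) = x"
  using assms by (simp_all add: matrix_inv_O21 SO21_carrierD(1) ladj_mult_left ladj_mult_right matrix_vector_mul_assoc)

lemma SO21_lor: "A \<in> carrier SO21 \<Longrightarrow> lor (A *v x) (A *v y) = lor x y"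
  by (simp add: O21D SO21_carrierD(1))

lemma lor_matrix_inv: "A \<in> carrier SO21 \<Longrightarrow> lor (matrix_inv A *v x) y = lor x (A *v y)"
  by (simp add: matrix_inv_O21 SO21_carrierD(1) lor_ladj)

text \<open>Reversed Cauchy--Schwarz: a causal and a timelike vector in the same time cone.\<close>

lemma causal_positive:
  fixes a b c x y z :: real
  assumes "a\<^sup>2 + b\<^sup>2 < c\<^sup>2" "c > 0" "x\<^sup>2 + y\<^sup>2 \<le> z\<^sup>2" "z > 0"
  shows "a * x + b * y + c * z > 0"
proof -
  have "(a * x + b * y)\<^sup>2 + (a * y - b * x)\<^sup>2 = (a\<^sup>2 + b\<^sup>2) * (x\<^sup>2 + y\<^sup>2)"
    by (simp add: power2_eq_square algebra_simps)
  then have "(a * x + b * y)\<^sup>2 \<le> (a\<^sup>2 + b\<^sup>2) * (x\<^sup>2 + y\<^sup>2)" by (smt (verit) zero_le_power2)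
  also have "\<dots> \<le> (a\<^sup>2 + b\<^sup>2) * z\<^sup>2" using assms by (intro mult_left_mono) auto
  also have "\<dots> < c\<^sup>2 * z\<^sup>2" using assms by (intro mult_strict_right_mono) auto
  finally have "\<bar>a * x + b * y\<bar>\<^sup>2 < (c * z)\<^sup>2" by (simp add: power_mult_distrib)
  then have "\<bar>a * x + b * y\<bar> < c * z"
    by (rule power2_less_imp_less) (use assms in simp)
  then show ?thesis by linarith
qed

text \<open>The last row of the matrix is timelike, by the normalisation of the rows.\<close>

lemma SO21_future:
  assumes "A \<in> carrier SO21" "lor x x \<le> 0" "x$3 > 0"
  shows "(A *v x)$3 > 0"
  unfolding matrix_vector_3
  by (rule causal_positive)
     (use assms SO21_carrierD[OF assms(1)] O21_row_3 in \<open>auto simp: lor_def power2_eq_square\<close>)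

lemma SO21_H2: "A \<in> carrier SO21 \<Longrightarrow> x \<in> H2 \<Longrightarrow> A *v x \<in> H2"
  using SO21_future[of A x] by (simp add: H2_def SO21_lor)

lemma lor_future_neg:
  assumes "lor x x < 0" "x$3 > 0" "lor y y \<le> 0" "y$3 > 0"
  shows "lor x y < 0"
  using causal_positive[of "- x$1" "- x$2" "x$3" "y$1" "y$2" "y$3"] assms
  by (simp add: lor_def power2_eq_square)

lemma null_orthogonal_parallel:
  assumes "lor v v = 0" "lor w w = 0" "lor v w = 0"
  shows "w$3 *\<^sub>R v = v$3 *\<^sub>R w"
proof -
  have "(w$3 * v$1 - v$3 * w$1)\<^sup>2 + (w$3 * v$2 - v$3 * w$2)\<^sup>2 =
     (w$3)\<^sup>2 * lor v v + (v$3)\<^sup>2 * lor w w - 2 * (w$3 * v$3) * lor v w"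
    by (simp add: lor_def power2_eq_square algebra_simps)
  also have "\<dots> = 0" by (simp add: assms)
  finally have "w$3 * v$1 - v$3 * w$1 = 0 \<and> w$3 * v$2 - v$3 * w$2 = 0"
    by (simp add: sum_power2_eq_zero_iff)
  then show ?thesis by (simp add: vec_eq_iff forall_3)
qed

lemma null_orthogonal_nonneg:
  assumes "lor n n = 0" "n$3 > 0" "lor v n = 0"
  shows "lor v v \<ge> 0"
proof (rule ccontr)
  assume "\<not> ?thesis"
  then have neg: "lor v v < 0" by simp
  then have "v$3 \<noteq> 0" by (auto simp: lor_def) (smt (verit) zero_le_square)
  then show False
    using lor_future_neg[of v n] lor_future_neg[of "-v" n] neg assms
    by (cases "v$3 > 0") (auto simp: lor_bilinear)
qed

lemma null_eq_0_iff: "lor v v = 0 \<Longrightarrow> v = 0 \<longleftrightarrow> v$3 = 0"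
proof -
  assume "lor v v = 0"
  then have "(v$1)\<^sup>2 + (v$2)\<^sup>2 = (v$3)\<^sup>2" by (simp add: lor_def power2_eq_square)
  then show ?thesis
    by (auto simp: vec_eq_iff forall_3 sum_power2_eq_zero_iff)
qed

lemma det_gram:
  "(det (vector [x, y, z] :: real^3^3))\<^sup>2 =
    lor x x * (lor y z)\<^sup>2 + lor y y * (lor x z)\<^sup>2 + lor z z * (lor x y)\<^sup>2
    - lor x x * lor y y * lor z z - 2 * lor x y * lor y z * lor x z"
  unfolding det_3 lor_def vector_3 by algebra

text \<open>A null frame: one non-null vector and two non-proportional null vectors orthogonal to it.\<close>

lemma null_frame_expand:
  assumes "lor v v = d" "d \<noteq> 0" "lor m m = 0" "lor p p = 0" "lor v m = 0" "lor v p = 0"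
    "lor m p = c" "c \<noteq> 0"
  shows "x = (lor x v / d) *\<^sub>R v + (lor x p / c) *\<^sub>R m + (lor x m / c) *\<^sub>R p"
proof -
  define M :: "real^3^3" where "M = vector [v, m, p]"
  define y where "y = x - ((lor x v / d) *\<^sub>R v + (lor x p / c) *\<^sub>R m + (lor x m / c) *\<^sub>R p)"
  have y: "lor v y = 0" "lor m y = 0" "lor p y = 0"
    using assms by (simp_all add: y_def lor_bilinear lor_commute[of m v] lor_commute[of p v]
      lor_commute[of p m] lor_commute[of v x] lor_commute[of m x] lor_commute[of p x])
  have "(det M)\<^sup>2 = d * c\<^sup>2" by (simp add: M_def det_gram assms)
  then have "det M \<noteq> 0" using assms by auto
  define z :: "real^3" where "z = vector [y$1, y$2, - y$3]"
  have "M *v z = 0"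
    using y by (simp add: M_def z_def vec_eq_iff forall_3 matrix_vector_3 lor_def)
  then have "z = 0"
    using \<open>det M \<noteq> 0\<close> invertible_det_nz[of M] invertible_left_inverse[of M] matrix_left_invertible_ker[of M] by blast
  then have "y = 0" by (simp add: z_def vec_eq_iff forall_3)
  then show ?thesis by (simp add: y_def)
qed

lemma eigenvectors_orthogonal:
  assumes "A \<in> O21" "A *v v = a *\<^sub>R v" "A *v w = b *\<^sub>R w" "a * b \<noteq> 1"
  shows "lor v w = 0"
  using O21D[OF assms(1), of v w] assms(2-4) by (auto simp: lor_bilinear mult.commute)

lemma null_norm: "lor v v = 0 \<Longrightarrow> v$3 > 0 \<Longrightarrow> norm v = sqrt 2 * v$3"
proof -
  assume "lor v v = 0" "v$3 > 0"
  then have "(norm v)\<^sup>2 = 2 * (v$3)\<^sup>2"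
    unfolding power2_norm_eq_inner by (simp add: inner_vec_def sum_3 lor_def power2_eq_square)
  also have "\<dots> = (sqrt 2 * v$3)\<^sup>2" by (simp add: power_mult_distrib)
  finally have "(norm v)\<^sup>2 = (sqrt 2 * v$3)\<^sup>2" .
  then show ?thesis using \<open>v$3 > 0\<close> power2_eq_imp_eq by force
qed

text \<open>An eigenvector for \<open>e\<close> with \<open>e\<^sup>2 \<noteq> 1\<close> is null, and two of them are orthogonal, hence proportional.\<close>

lemma null_eigvec_unique:
  assumes A: "A \<in> O21" and e: "eigval A e" "e > 0" "e \<noteq> 1"
  shows "\<exists>!v. null_eigvec A e v"
proof -
  have ee: "e * e \<noteq> 1" using e square_eq_1_iff[of e] by auto
  obtain v where v: "v \<noteq> 0" "A *v v = e *\<^sub>R v" using e(1) by (auto simp: eigval_def)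
  have null: "lor v v = 0" by (rule eigenvectors_orthogonal[OF A v(2) v(2) ee])
  define s where "s = 1 / (sqrt 2 * v$3)"
  have v3: "v$3 \<noteq> 0" using null v(1) null_eq_0_iff by blast
  have "null_eigvec A e (s *\<^sub>R v)"
    unfolding null_eigvec_def
  proof (intro conjI)
    show 1: "lor (s *\<^sub>R v) (s *\<^sub>R v) = 0" by (simp add: lor_bilinear null)
    show 2: "0 < (s *\<^sub>R v) $ 3" using v3 by (simp add: s_def)
    show "norm (s *\<^sub>R v) = 1" unfolding null_norm[OF 1 2] using v3 by (simp add: s_def)
  qed (use v in \<open>simp add: matrix_vector_mult_scaleR\<close>)
  moreover have "x = y" if "null_eigvec A e x" "null_eigvec A e y" for x y
  proof -
    have x: "lor x x = 0" "x$3 > 0" "norm x = 1" "A *v x = e *\<^sub>R x"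
      and y: "lor y y = 0" "y$3 > 0" "norm y = 1" "A *v y = e *\<^sub>R y"
      using that by (auto simp: null_eigvec_def)
    have "y$3 *\<^sub>R x = x$3 *\<^sub>R y"
      using null_orthogonal_parallel eigenvectors_orthogonal[OF A x(4) y(4) ee] x y by blast
    moreover have "x$3 = y$3" using null_norm[OF x(1,2)] null_norm[OF y(1,2)] x(3) y(3)
      by (metis mult_cancel_left mult_zero_left zero_neq_one)
    ultimately show ?thesis using x(2) by simp
  qed
  ultimately show ?thesis by blast
qed

lemma hyperbolic_eig:
  assumes "hyperbolic A"
  shows "A \<in> carrier SO21" "0 < eig A" "eig A < 1" "{e. eigval A e} = {eig A, 1, 1 / eig A}"
proof -
  obtain l where l: "0 < l" "l < 1" "{e. eigval A e} = {l, 1, 1 / l}" and A: "A \<in> carrier SO21"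
    using assms by (auto simp: hyperbolic_def)
  have ev: "eigval A e \<longleftrightarrow> e = l \<or> e = 1 \<or> e = 1 / l" for e using l(3) by blast
  have "eig A = l"
    unfolding eig_def
  proof (rule the_equality)
    fix e assume "0 < e \<and> e < 1 \<and> eigval A e"
    then show "e = l" using ev[of e] l by auto
  qed (use l ev in auto)
  then show "A \<in> carrier SO21" "0 < eig A" "eig A < 1" "{e. eigval A e} = {eig A, 1, 1 / eig A}"
    using l A by auto
qed

lemma hyperbolic_null:
  assumes "hyperbolic A"
  shows "null_eigvec A (eig A) (Xm A)" "null_eigvec A (1 / eig A) (Xp A)"
proof -
  note h = hyperbolic_eig[OF assms]
  note O = SO21_carrierD(1)[OF h(1)]
  have "eigval A (eig A)" "eigval A (1 / eig A)" using h(4) by blast+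
  then have "\<exists>!v. null_eigvec A (eig A) v" "\<exists>!v. null_eigvec A (1 / eig A) v"
    using h(2,3) null_eigvec_unique[OF O, of "eig A"] null_eigvec_unique[OF O, of "1 / eig A"] by simp_all
  then show "null_eigvec A (eig A) (Xm A)" "null_eigvec A (1 / eig A) (Xp A)"
    unfolding Xm_def Xp_def by (auto intro: theI')
qed

lemma hyperbolic_Xm_Xp:
  assumes "hyperbolic A"
  shows "A *v Xm A = eig A *\<^sub>R Xm A" "lor (Xm A) (Xm A) = 0" "Xm A $ 3 > 0"
    "A *v Xp A = (1 / eig A) *\<^sub>R Xp A" "lor (Xp A) (Xp A) = 0" "Xp A $ 3 > 0"
    "lor (Xm A) (Xp A) \<noteq> 0"
proof -
  show a: "A *v Xm A = eig A *\<^sub>R Xm A" "lor (Xm A) (Xm A) = 0" "Xm A $ 3 > 0"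
    "A *v Xp A = (1 / eig A) *\<^sub>R Xp A" "lor (Xp A) (Xp A) = 0" "Xp A $ 3 > 0"
    using hyperbolic_null[OF assms] by (auto simp: null_eigvec_def)
  show "lor (Xm A) (Xp A) \<noteq> 0"
  proof
    assume "lor (Xm A) (Xp A) = 0"
    then have eq: "Xp A$3 *\<^sub>R Xm A = Xm A$3 *\<^sub>R Xp A"
      using a null_orthogonal_parallel by blast
    then have "Xp A$3 *\<^sub>R (A *v Xm A) = Xm A$3 *\<^sub>R (A *v Xp A)"
      by (metis matrix_vector_mult_scaleR)
    then have "eig A *\<^sub>R (Xp A$3 *\<^sub>R Xm A) = (1 / eig A) *\<^sub>R (Xm A$3 *\<^sub>R Xp A)"
      by (simp add: a mult.commute)
    then have "(eig A - 1 / eig A) *\<^sub>R (Xm A$3 *\<^sub>R Xp A) = 0"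
      by (simp add: eq algebra_simps)
    moreover have "Xp A \<noteq> 0" using a(6) by auto
    ultimately have "eig A = 1 / eig A" using a(3) by simp
    then have "eig A * eig A = 1" using hyperbolic_eig(2)[OF assms] by (simp add: field_simps)
    then show False using hyperbolic_eig(2,3)[OF assms]
      by (smt (verit) mult_left_le)
  qed
qed

text \<open>A fixed vector is orthogonal to both null eigenvectors, which forces it to be spacelike and leaves
  only its length and its sign to be chosen.\<close>

lemma hyperbolic_X0:
  assumes "hyperbolic A"
  shows "A *v X0 A = X0 A" "lor (X0 A) (X0 A) = 1"
    "lor (X0 A) (Xm A) = 0" "lor (X0 A) (Xp A) = 0"
proof -
  note h = hyperbolic_eig[OF assms] and n = hyperbolic_Xm_Xp[OF assms]
  note O = SO21_carrierD(1)[OF h(1)]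
  have orth: "lor v (Xm A) = 0" "lor v (Xp A) = 0" if "A *v v = v" for v
    using eigenvectors_orthogonal[OF O, of v 1 "Xm A" "eig A"] eigenvectors_orthogonal[OF O, of v 1 "Xp A" "1 / eig A"]
      that n(1,4) h(2,3) by simp_all
  have "eigval A 1" using h(4) by blast
  then obtain v where v: "v \<noteq> 0" "A *v v = v" by (auto simp: eigval_def)
  have "lor v v \<ge> 0" using null_orthogonal_nonneg n(2,3) orth(1)[OF v(2)] by blast
  moreover have "lor v v \<noteq> 0"
  proof
    assume v0: "lor v v = 0"
    then have "Xm A$3 *\<^sub>R v = v$3 *\<^sub>R Xm A" using null_orthogonal_parallel n(2) orth(1)[OF v(2)] by blast
    moreover have "v$3 *\<^sub>R Xp A = Xp A$3 *\<^sub>R v"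
      using null_orthogonal_parallel[OF n(5) v0] orth(2)[OF v(2)] lor_commute by metis
    ultimately have "lor (v$3 *\<^sub>R Xm A) (v$3 *\<^sub>R Xp A) = 0"
      by (metis lor_scale_left lor_scale_right mult_zero_right v0)
    then have "v$3 = 0" using n(7) by (simp add: lor_bilinear)
    then show False using v(1) v0 null_eq_0_iff by blast
  qed
  ultimately have pos: "lor v v > 0" by simp
  define w where "w = (1 / sqrt (lor v v)) *\<^sub>R v"
  have w: "A *v w = w" "lor w w = 1"
    using v(2) pos by (simp_all add: w_def matrix_vector_mult_scaleR lor_bilinear)
  let ?d = "\<lambda>v. det (vector [v, Xm A, Xp A] :: real^3^3)"
  have dneg: "?d (- x) = - ?d x" for x by (simp add: det_3)
  have "(?d w)\<^sup>2 = (lor (Xm A) (Xp A))\<^sup>2" by (simp add: det_gram w orth n)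
  then have dw: "?d w \<noteq> 0" using n(7) by auto
  define w' where "w' = (if ?d w > 0 then w else - w)"
  have w': "A *v w' = w'" "lor w' w' = 1" "?d w' > 0"
    using w dw dneg[of w] by (auto simp: w'_def lor_bilinear matrix_vector_minus) 
  have uniq: "x = w'" if x: "A *v x = x \<and> lor x x = 1 \<and> ?d x > 0" for x
  proof -
    have ex: "x = lor x w' *\<^sub>R w'"
      using null_frame_expand[OF w'(2) _ n(2,5) orth[OF w'(1)] refl n(7), of x] orth[of x] x by simp
    then have "lor x x = lor x w' * lor x w'" using w'(2) by (metis lor_scale_left lor_scale_right mult.right_neutral)
    then have "lor x w' = 1 \<or> lor x w' = -1" using x by (metis power2_eq_square power2_eq_1_iff)
    moreover have "lor x w' \<noteq> -1"
    proof
      assume "lor x w' = -1"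
      then have "x = - w'" using ex by simp
      then show False using x w'(3) dneg[of w'] by simp
    qed
    ultimately show ?thesis using ex by simp
  qed
  have "X0 A = w'" unfolding X0_def by (rule the_equality[OF _ uniq]) (simp_all add: w')
  then show "A *v X0 A = X0 A" "lor (X0 A) (X0 A) = 1"
    "lor (X0 A) (Xm A) = 0" "lor (X0 A) (Xp A) = 0"
    using w'(1,2) orth[OF w'(1)] by simp_all
qed

lemma hyperbolic_expand:
  assumes "hyperbolic A"
  shows "x = lor x (X0 A) *\<^sub>R X0 A + (lor x (Xp A) / lor (Xm A) (Xp A)) *\<^sub>R Xm A
    + (lor x (Xm A) / lor (Xm A) (Xp A)) *\<^sub>R Xp A"
  using null_frame_expand[OF hyperbolic_X0(2) _ hyperbolic_Xm_Xp(2,5) hyperbolic_X0(3,4) refl hyperbolic_Xm_Xp(7), of A x]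
    assms by simp

text \<open>Being orthogonal to \<open>X0 A\<close>, the vector is \<open>a Xm + b Xp\<close> with square \<open>2 a b lor Xm Xp = 0\<close>, so one
  coefficient vanishes.\<close>

lemma hyperbolic_orthogonal_null_eigenvector:
  assumes "hyperbolic A" "lor n n = 0" "lor n (X0 A) = 0"
  shows "\<exists>\<mu>. A *v n = \<mu> *\<^sub>R n"
proof -
  note X = hyperbolic_Xm_Xp[OF assms(1)]
  define a b where "a = lor n (Xp A) / lor (Xm A) (Xp A)" and "b = lor n (Xm A) / lor (Xm A) (Xp A)"
  have n: "n = a *\<^sub>R Xm A + b *\<^sub>R Xp A"
    using hyperbolic_expand[OF assms(1), of n] assms(3) by (simp add: a_def b_def)
  have "lor n n = 2 * a * b * lor (Xm A) (Xp A)"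
    by (simp add: n lor_bilinear X lor_commute[of "Xp A" "Xm A"])
  then have "a = 0 \<or> b = 0" using assms(2) X(7) by simp
  then show ?thesis
  proof
    assume "a = 0"
    then have "A *v n = (1 / eig A) *\<^sub>R n" by (simp add: n matrix_vector_mult_scaleR X)
    then show ?thesis by blast
  next
    assume "b = 0"
    then have "A *v n = eig A *\<^sub>R n" by (simp add: n matrix_vector_mult_scaleR X)
    then show ?thesis by blast
  qed
qed

lemma hyperbolic_no_fixed_null:
  assumes "hyperbolic A" "lor n n = 0" "A *v n = n"
  shows "n = 0"
proof -
  note X = hyperbolic_Xm_Xp[OF assms(1)] and h = hyperbolic_eig[OF assms(1)]
  note O = SO21_carrierD(1)[OF h(1)]
  have "lor n (Xm A) = 0" "lor n (Xp A) = 0"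
    using eigenvectors_orthogonal[OF O, of n 1 "Xm A" "eig A"] eigenvectors_orthogonal[OF O, of n 1 "Xp A" "1 / eig A"]
      assms(3) X(1,4) h(2,3) by simp_all
  then have n: "n = lor n (X0 A) *\<^sub>R X0 A" using hyperbolic_expand[OF assms(1), of n] by simp
  then have "lor n n = (lor n (X0 A))\<^sup>2" using hyperbolic_X0(2)[OF assms(1)]
    by (metis lor_scale_left lor_scale_right mult.right_neutral power2_eq_square)
  then show ?thesis using assms(2) n by simp
qed

lemma fixed_timelike_H2:
  assumes "A *v v = v" "lor v v < 0"
  shows "\<exists>x\<in>H2. A *v x = x"
proof -
  define s where "s = sgn (v$3) / sqrt (- lor v v)"
  have v3: "v$3 \<noteq> 0" using assms(2) by (auto simp: lor_def) (smt (verit) zero_le_square)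
  have "lor (s *\<^sub>R v) (s *\<^sub>R v) = -1"
    using assms(2) v3 by (simp add: lor_bilinear s_def field_simps sgn_if)
  moreover have "(s *\<^sub>R v)$3 > 0" using v3 assms(2)
    by (simp add: s_def sgn_if mult_neg_neg divide_less_0_iff)
  moreover have "A *v (s *\<^sub>R v) = s *\<^sub>R v" using assms(1) by (simp add: matrix_vector_mult_scaleR)
  ultimately show ?thesis by (auto simp: H2_def)
qed

text \<open>In odd dimension \<open>A - 1 = A (1 - A\<^sup>*)\<close>, with the Lorentz adjoint \<open>A\<^sup>*\<close>, gives
  \<open>det (A - 1) = - det (A - 1)\<close>.\<close>

lemma SO21_fixed_vector:
  assumes "A \<in> carrier SO21"
  shows "\<exists>v. v \<noteq> 0 \<and> A *v v = v"
proof -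
  note A = SO21_carrierD[OF assms]
  have "(A - mat 1) *v x = (A ** (mat 1 - ladj A)) *v x" for x
  proof -
    have "(A ** (mat 1 - ladj A)) *v x = A *v (x - ladj A *v x)"
      by (simp add: matrix_vector_mult_diff_rdistrib flip: matrix_vector_mul_assoc)
    also have "\<dots> = A *v x - (A ** ladj A) *v x"
      by (simp add: matrix_vector_mult_diff_distrib matrix_vector_mul_assoc)
    finally show ?thesis
      by (simp add: ladj_mult_right[OF A(1)] matrix_vector_mult_diff_rdistrib)
  qed
  then have "A - mat 1 = A ** (mat 1 - ladj A)" by (simp add: matrix_eq)
  also have "mat 1 - ladj A = ladj (- (A - mat 1))"
    by (simp add: ladj_def vec_eq_iff mat_def)
  finally have "det (A - mat 1) = det A * det (ladj (- (A - mat 1)))"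
    by (metis det_mul)
  also have "\<dots> = - det (A - mat 1)" 
    unfolding det_ladj A(2) mult_1 by (simp only: det_3 vector_uminus_component)
  finally have "det (A - mat 1) = 0" by simp
  then obtain v where "v \<noteq> 0" "(A - mat 1) *v v = 0"
    using invertible_det_nz[of "A - mat 1"] invertible_left_inverse[of "A - mat 1"] matrix_left_invertible_ker[of "A - mat 1"] by blast
  then show ?thesis by (auto simp: matrix_vector_mult_diff_rdistrib)
qed

text \<open>The causal type of a fixed vector decides. If it is spacelike, the plane orthogonal to it contains
  two null lines. If \<open>A\<close> preserves them, it is hyperbolic or fixes null vectors; if it swaps them, it
  fixes a point of the hyperbolic plane.\<close>

lemma SO21_trichotomy:
  assumes A: "A \<in> carrier SO21"
  shows "hyperbolic A \<or> (\<exists>x\<in>H2. A *v x = x) \<or> (\<exists>n. lor n n = 0 \<and> n$3 > 0 \<and> A *v n = n)"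
proof -
  note AO = SO21_carrierD(1)[OF A]
  obtain v where v: "v \<noteq> 0" "A *v v = v" using SO21_fixed_vector[OF A] by blast
  consider "lor v v < 0" | "lor v v = 0" | "lor v v > 0" by linarith
  then show ?thesis
  proof cases
    case 1 then show ?thesis using fixed_timelike_H2 v by blast
  next
    case 2
    then have "v$3 \<noteq> 0" using v(1) null_eq_0_iff by blast
    moreover have "A *v (-v) = -v" using v(2) by (simp add: matrix_vector_minus)
    ultimately show ?thesis using 2 v(2)
      by (cases "v$3 > 0") (force simp: lor_bilinear intro: exI[of _ v] exI[of _ "-v"])+
  next
    case 3
    define a b c s where "a = v$1" and "b = v$2" and "c = v$3" and "s = sqrt (lor v v)"
    have s: "s\<^sup>2 = a\<^sup>2 + b\<^sup>2 - c\<^sup>2" "s > 0" using 3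
      by (simp_all add: s_def lor_def a_def b_def c_def power2_eq_square)
    have r: "a\<^sup>2 + b\<^sup>2 > 0" using s by (smt (verit) zero_le_power2 zero_less_power2)
    \<comment> \<open>The two future null directions of the plane orthogonal to \<open>v\<close>.\<close>
    define n n' :: "real^3" where "n = vector [a * c - b * s, b * c + a * s, a\<^sup>2 + b\<^sup>2]"
      and "n' = vector [a * c + b * s, b * c - a * s, a\<^sup>2 + b\<^sup>2]"
    have n: "lor v n = 0" "lor v n' = 0" "n$3 > 0" "n'$3 > 0"
      using r by (simp_all add: n_def n'_def lor_def a_def b_def c_def power2_eq_square algebra_simps)
    have null: "lor n n = 0" "lor n' n' = 0"
      using s(1) unfolding lor_def n_def n'_def vector_3 by algebra+
    have "lor n n' = - 2 * s\<^sup>2 * (a\<^sup>2 + b\<^sup>2)"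
      using s(1) unfolding lor_def n_def n'_def vector_3 by algebra
    moreover have "- 2 * s\<^sup>2 * (a\<^sup>2 + b\<^sup>2) < 0" using s(2) r by (intro mult_neg_pos) simp_all
    ultimately have nn: "lor n n' < 0" by simp
    then have nn': "lor n n' \<noteq> 0" by simp
    have ex: "x = (lor x v / lor v v) *\<^sub>R v + (lor x n' / lor n n') *\<^sub>R n + (lor x n / lor n n') *\<^sub>R n'" for x
      using null_frame_expand[OF refl _ null n(1,2) refl nn', of x] 3 by simp
    have img: "(\<exists>\<mu>>0. A *v x = \<mu> *\<^sub>R n) \<or> (\<exists>\<mu>>0. A *v x = \<mu> *\<^sub>R n')"
      if x: "lor x x = 0" "x$3 > 0" "lor v x = 0" for x
    proof -
      define y p q where "y = A *v x" and "p = lor y n' / lor n n'" and "q = lor y n / lor n n'"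
      have y: "lor y y = 0" "y$3 > 0" "lor y v = 0"
        using x SO21_future[OF A, of x] SO21_lor[OF A, of x x] SO21_lor[OF A, of x v] v(2)
        by (simp_all add: y_def lor_commute)
      have yy: "y = p *\<^sub>R n + q *\<^sub>R n'" using ex[of y] y(3) by (simp add: p_def q_def)
      have "lor y y = 2 * p * q * lor n n'"
        by (simp add: yy lor_bilinear null lor_commute[of n' n])
      then have "p = 0 \<or> q = 0" using y(1) nn' by simp
      then show ?thesis
        using yy y(2) n(3,4) unfolding y_def[symmetric] by (auto simp: zero_less_mult_iff)
    qed
    have inj: "A *v x = A *v y \<Longrightarrow> x = y" for x y
      by (metis A matrix_inv_cancel(4))
    have notpar: "\<mu> *\<^sub>R n \<noteq> \<nu> *\<^sub>R n'" if "\<mu> > 0" for \<mu> \<nu>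
    proof
      assume "\<mu> *\<^sub>R n = \<nu> *\<^sub>R n'"
      then have "lor (\<mu> *\<^sub>R n) n' = lor (\<nu> *\<^sub>R n') n'" by simp
      then show False using that nn' null by (simp add: lor_bilinear)
    qed
    from img[OF null(1) n(3,1)] show ?thesis
    proof (elim disjE exE conjE)
      fix \<mu> :: real assume \<mu>: "\<mu> > 0" "A *v n = \<mu> *\<^sub>R n"
      have "A *v n' \<noteq> \<nu> *\<^sub>R n" if "\<nu> > 0" for \<nu>
      proof
        assume "A *v n' = \<nu> *\<^sub>R n"
        then have "A *v (\<nu> *\<^sub>R n) = A *v (\<mu> *\<^sub>R n')" using \<mu>(2) by (simp add: matrix_vector_mult_scaleR mult.commute)
        then show False using inj notpar that by blast
      qed
      then obtain \<nu> where \<nu>: "\<nu> > 0" "A *v n' = \<nu> *\<^sub>R n'" using img[OF null(2) n(4,2)] by blast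
      have "\<nu> * \<mu> = 1" using SO21_lor[OF A, of n n'] nn' by (simp add: \<mu> \<nu> lor_bilinear)
      then have \<nu>': "\<nu> = 1 / \<mu>" using \<mu>(1) by (simp add: field_simps)
      show ?thesis
      proof (cases "\<mu> = 1")
        case True then show ?thesis using \<mu> null n by auto
      next
        case False
        have "eigval A \<mu>" "eigval A (1 / \<mu>)" "eigval A 1"
          using \<mu> \<nu> \<nu>' v n unfolding eigval_def
          by (metis less_irrefl zero_index, metis less_irrefl zero_index, metis scaleR_one)
        moreover have "e \<in> {\<mu>, 1, 1 / \<mu>}" if ev: "eigval A e" for e
        proof (rule ccontr)
          assume e: "e \<notin> {\<mu>, 1, 1 / \<mu>}"
          obtain x where x: "x \<noteq> 0" "A *v x = e *\<^sub>R x" using ev by (auto simp: eigval_def)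
          have "lor x v = 0" using eigenvectors_orthogonal[OF AO x(2), of v 1] v(2) e by simp
          moreover have "lor x n = 0"
            using eigenvectors_orthogonal[OF AO x(2) \<mu>(2)] e \<mu>(1) by (force simp: field_simps)
          moreover have "lor x n' = 0"
            using eigenvectors_orthogonal[OF AO x(2) \<nu>(2)] e \<mu>(1) \<nu>' by (force simp: field_simps)
          ultimately show False using ex[of x] x(1) by simp
        qed
        ultimately have ev: "{e. eigval A e} = {\<mu>, 1, 1 / \<mu>}" by auto
        have "hyperbolic A"
        proof (cases "\<mu> < 1")
          case True then show ?thesis using ev \<mu>(1) A by (auto simp: hyperbolic_def)
        next
          case F: False
          then have "0 < 1 / \<mu> \<and> 1 / \<mu> < 1 \<and> {e. eigval A e} = {1 / \<mu>, 1, 1 / (1 / \<mu>)}"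
            using ev False \<mu>(1) by auto
          then show ?thesis using A unfolding hyperbolic_def by blast
        qed
        then show ?thesis by simp
      qed
    next
      fix \<mu> :: real assume \<mu>: "\<mu> > 0" "A *v n = \<mu> *\<^sub>R n'"
      have "A *v n' \<noteq> \<nu> *\<^sub>R n'" if "\<nu> > 0" for \<nu>
      proof
        assume "A *v n' = \<nu> *\<^sub>R n'"
        then have "A *v (\<nu> *\<^sub>R n) = A *v (\<mu> *\<^sub>R n')" using \<mu>(2) by (simp add: matrix_vector_mult_scaleR mult.commute)
        then show False using inj notpar that by blast
      qed
      then obtain \<nu> where \<nu>: "\<nu> > 0" "A *v n' = \<nu> *\<^sub>R n" using img[OF null(2) n(4,2)] by blast
      have "\<nu> * \<mu> = 1" using SO21_lor[OF A, of n n'] nn'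
        by (simp add: \<mu> \<nu> lor_bilinear lor_commute[of n' n])
      then have one: "\<mu> * \<nu> = 1" by (metis mult.commute)
      \<comment> \<open>Swapping the two null lines, \<open>A\<close> fixes a point of the geodesic between them.\<close>
      have fixed: "A *v (n + \<mu> *\<^sub>R n') = n + \<mu> *\<^sub>R n'"
        by (simp add: matrix_vector_right_distrib matrix_vector_mult_scaleR \<mu> \<nu> one)
      have "lor (n + \<mu> *\<^sub>R n') (n + \<mu> *\<^sub>R n') < 0"
        using \<mu>(1) nn by (simp add: lor_bilinear null lor_commute[of n' n] mult_pos_neg)
      then show ?thesis using fixed_timelike_H2 fixed by blast
    qed
  qed
qed

section \<open>Hyperbolicity of elements of infinite order\<close>

lemma subgroup_SO21D:
  assumes "subgroup G SO21"
  shows "A \<in> G \<Longrightarrow> A \<in> carrier SO21" "mat 1 \<in> G" "A \<in> G \<Longrightarrow> B \<in> G \<Longrightarrow> A ** B \<in> G"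
    "A \<in> G \<Longrightarrow> matrix_inv A \<in> G"
proof -
  show c: "A \<in> G \<Longrightarrow> A \<in> carrier SO21" using subgroup.mem_carrier[OF assms] .
  show "mat 1 \<in> G" using subgroup.one_closed[OF assms] by (simp add: SO21_one_eq)
  show "A \<in> G \<Longrightarrow> B \<in> G \<Longrightarrow> A ** B \<in> G" using subgroup.m_closed[OF assms] by (simp add: SO21_mult_eq)
  show "A \<in> G \<Longrightarrow> matrix_inv A \<in> G" using subgroup.m_inv_closed[OF assms] c SO21_inv_eq by metis
qed

lemma tendsto_matrix_mult:
  fixes f g :: "'a \<Rightarrow> real^3^3"
  assumes "(f \<longlongrightarrow> A) F" "(g \<longlongrightarrow> B) F"
  shows "((\<lambda>x. f x ** g x) \<longlongrightarrow> A ** B) F"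
  unfolding matrix_matrix_mult_def using assms by (intro tendsto_intros)

lemma tendsto_ladj:
  assumes "(f \<longlongrightarrow> A) F"
  shows "((\<lambda>x. ladj (f x)) \<longlongrightarrow> ladj A) F"
  unfolding ladj_def using assms by (intro tendsto_intros)

lemma tendsto_lor:
  assumes "(f \<longlongrightarrow> x) F" "(g \<longlongrightarrow> y) F"
  shows "((\<lambda>z. lor (f z) (g z)) \<longlongrightarrow> lor x y) F"
  unfolding lor_def using assms by (intro tendsto_intros)

text \<open>A discrete group of Lorentz matrices is closed, so its bounded sequences take some value
  infinitely often: consecutive quotients of a convergent sequence tend to the identity.\<close>

lemma discrete_subgroup_bounded_sequence:
  fixes D :: "nat \<Rightarrow> real^3^3"
  assumes G: "subgroup G SO21" and disc: "discrete G"
    and D: "\<And>n. D n \<in> G" "bounded (range D)"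
  shows "\<exists>r L. strict_mono (r :: nat \<Rightarrow> nat) \<and> L \<in> G \<and> (\<forall>n. D (r n) = L)"
proof -
  note G' = subgroup_SO21D[OF G]
  obtain l r where r: "strict_mono r" and lim: "(D \<circ> r) \<longlonglongrightarrow> l"
    using bounded_imp_convergent_subsequence[OF D(2)] by auto
  have DO: "D n \<in> O21" for n using G'(1)[OF D(1)] SO21_carrierD(1) by blast
  have lim': "(\<lambda>n. D (r n)) \<longlonglongrightarrow> l" using lim by (simp add: o_def)
  have "(\<lambda>n. ladj (D (r n)) ** D (r n)) \<longlonglongrightarrow> ladj l ** l"
    by (intro tendsto_matrix_mult tendsto_ladj lim')
  then have one: "ladj l ** l = mat 1"
    using LIMSEQ_unique[OF tendsto_const, of "mat 1" "ladj l ** l"] ladj_mult_left[OF DO] by simp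
  define E where "E = (\<lambda>n. ladj (D (r n)) ** D (r (Suc n)))"
  have E: "E \<longlonglongrightarrow> mat 1"
    unfolding E_def one[symmetric] by (intro tendsto_matrix_mult tendsto_ladj lim' LIMSEQ_Suc[OF lim'])
  have EG: "E n \<in> G" for n
    unfolding E_def using G'(3,4)[OF ] D(1) matrix_inv_O21[OF DO] by metis
  obtain T where T: "open T" "T \<inter> G = {mat 1}"
    using discreteD[OF disc G'(2)] unfolding isolated_in_def by blast
  have "eventually (\<lambda>n. E n \<in> T) sequentially"
    using topological_tendstoD[OF E T(1)] T(2) by blast
  then obtain N where N: "\<And>n. n \<ge> N \<Longrightarrow> E n = mat 1"
    using T(2) EG unfolding eventually_sequentially by blast
  have step: "D (r (Suc n)) = D (r n)" if "n \<ge> N" for n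
  proof -
    have "D (r n) ** E n = (D (r n) ** ladj (D (r n))) ** D (r (Suc n))"
      by (simp add: E_def matrix_mul_assoc)
    then show ?thesis using N[OF that] ladj_mult_right[OF DO] by simp
  qed
  have "D (r (N + n)) = D (r N)" for n
    by (induction n) (use step in auto)
  then have subseq: "strict_mono (\<lambda>n. r (N + n)) \<and> D (r N) \<in> G \<and> (\<forall>n. D (r (N + n)) = D (r N))"
    using r D(1) by (simp add: strict_mono_def)
  show ?thesis
    by (rule exI[of _ "\<lambda>n. r (N + n)"], rule exI[of _ "D (r N)"], rule subseq)
qed

text \<open>With \<open>u\<close> the Euclidean product of the first two components, \<open>- lor x y = x$3 * y$3 - u\<close>, and
  multiplying by the conjugate \<open>x$3 * y$3 + u\<close> turns the Cauchy--Schwarz inequality into a lower bound.\<close>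

lemma H2_component_bound:
  assumes "x \<in> H2" "y \<in> H2"
  shows "y$3 \<le> 2 * x$3 * (- lor x y)"
proof -
  define u where "u = x$1 * y$1 + x$2 * y$2"
  have x: "(x$1)\<^sup>2 + (x$2)\<^sup>2 = (x$3)\<^sup>2 - 1" "x$3 > 0" and y: "(y$1)\<^sup>2 + (y$2)\<^sup>2 = (y$3)\<^sup>2 - 1" "y$3 > 0"
    using assms by (auto simp: H2_def lor_def power2_eq_square)
  have "u\<^sup>2 + (x$1 * y$2 - x$2 * y$1)\<^sup>2 = ((x$1)\<^sup>2 + (x$2)\<^sup>2) * ((y$1)\<^sup>2 + (y$2)\<^sup>2)"
    by (simp add: u_def power2_eq_square algebra_simps)
  then have "u\<^sup>2 \<le> ((x$3)\<^sup>2 - 1) * ((y$3)\<^sup>2 - 1)" unfolding x y by (smt (verit) zero_le_power2)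
  moreover have "(x$3)\<^sup>2 \<ge> 1" using x(1) by (smt (verit) zero_le_power2)
  ultimately have u: "(y$3)\<^sup>2 \<le> (x$3 * y$3)\<^sup>2 - u\<^sup>2"
    by (simp add: algebra_simps power_mult_distrib)
  then have "u\<^sup>2 \<le> (x$3 * y$3)\<^sup>2" by (smt (verit) zero_le_power2)
  then have au: "\<bar>u\<bar> \<le> x$3 * y$3" using x(2) y(2) abs_le_square_iff[of u "x$3 * y$3"] by simp
  have "(y$3)\<^sup>2 \<le> (x$3 * y$3 - u) * (x$3 * y$3 + u)" using u by (simp add: power2_eq_square algebra_simps)
  also have "\<dots> \<le> (x$3 * y$3 - u) * (2 * x$3 * y$3)" using au by (intro mult_left_mono) auto
  finally have "y$3 * y$3 \<le> (2 * x$3 * (x$3 * y$3 - u)) * y$3" by (simp add: power2_eq_square algebra_simps)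
  then have "y$3 \<le> 2 * x$3 * (x$3 * y$3 - u)" using y(2) by simp
  then show ?thesis by (simp add: u_def lor_def)
qed

lemma SO21_norm_le:
  assumes "A \<in> carrier SO21"
  shows "norm A \<le> 18 * A$3$3"
proof -
  note A = SO21_carrierD[OF assms]
  have sq: "\<bar>x\<bar> \<le> 2 * A$3$3" if "x\<^sup>2 \<le> 2 * (A$3$3)\<^sup>2" for x
  proof -
    have "2 * (A$3$3)\<^sup>2 \<le> (2 * A$3$3)\<^sup>2" by (simp add: power_mult_distrib)
    then have "x\<^sup>2 \<le> (2 * A$3$3)\<^sup>2" using that by linarith
    then show ?thesis using A(3) abs_le_square_iff[of x "2 * A$3$3"] by simp
  qed
  have e: "(A$3$1)\<^sup>2 \<le> (A$3$3)\<^sup>2 - 1" "(A$3$2)\<^sup>2 \<le> (A$3$3)\<^sup>2 - 1"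
    using O21_row_3[OF A(1)] by (smt (verit) zero_le_power2)+
  have entry: "\<bar>A$i$j\<bar> \<le> 2 * A$3$3" for i j
  proof (rule sq)
    have "\<forall>i j. (A$i$j)\<^sup>2 \<le> 2 * (A$3$3)\<^sup>2"
      unfolding forall_3 using O21_columns[OF A(1)] e by (smt (verit) zero_le_power2)
    then show "(A$i$j)\<^sup>2 \<le> 2 * (A$3$3)\<^sup>2" by blast
  qed
  have row: "norm (A$i) \<le> 6 * A$3$3" for i
    using norm_le_l1_cart[of "A$i"] entry[of i 1] entry[of i 2] entry[of i 3] by (simp add: sum_3)
  have "(\<Sum>i\<in>UNIV. norm (A$i)) \<le> 18 * A$3$3"
    using row[of 1] row[of 2] row[of 3] by (simp add: sum_3)
  moreover have "norm A \<le> (\<Sum>i\<in>UNIV. norm (A$i))" unfolding norm_vec_def by (rule L2_set_le_sum) simp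
  ultimately show ?thesis by linarith
qed

text \<open>The lower right entry bounds all entries of a Lorentz matrix. It measures how far the base point
  \<open>axis 3 1\<close> is moved, which is bounded by the displacement of \<open>x\<close> and the distance of \<open>x\<close> from it.\<close>

lemma SO21_norm_le_displacement:
  assumes A: "A \<in> carrier SO21" and x: "x \<in> H2" "x$3 \<le> R" and d: "- lor x (A *v x) \<le> M"
  shows "norm A \<le> 72 * R\<^sup>2 * M"
proof -
  have e: "axis 3 1 \<in> H2" by (simp add: H2_def lor_def axis_def)
  have x3: "x$3 > 0" using x by (simp add: H2_def)
  note Ax = SO21_H2[OF A x(1)] 
  have le: "(A *v x)$3 \<le> 2 * x$3 * (- lor x (A *v x))" by (rule H2_component_bound[OF x(1) Ax])
  have p: "(A *v x)$3 > 0" using Ax by (simp add: H2_def)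
  have "A$3$3 = (A *v axis 3 1)$3" by (simp add: matrix_vector_3 axis_def)
  also have "\<dots> \<le> 2 * (A *v x)$3 * (- lor (A *v x) (A *v axis 3 1))"
    by (rule H2_component_bound[OF Ax SO21_H2[OF A e]])
  also have "\<dots> = 2 * (A *v x)$3 * x$3"
    unfolding SO21_lor[OF A] by (simp add: lor_def axis_def)
  also have "\<dots> \<le> 2 * (2 * x$3 * (- lor x (A *v x))) * x$3"
    using le x3 by (intro mult_right_mono mult_left_mono) auto
  also have "\<dots> = 4 * (x$3)\<^sup>2 * (- lor x (A *v x))" by (simp add: power2_eq_square)
  also have "\<dots> \<le> 4 * R\<^sup>2 * M"
  proof (rule mult_mono)
    show "4 * (x$3)\<^sup>2 \<le> 4 * R\<^sup>2" using x(2) x3 by (simp add: power_mono)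
    show "0 \<le> - lor x (A *v x)" using le p x3 by (smt (verit) mult_pos_neg)
  qed (use d in auto)
  finally show ?thesis using SO21_norm_le[OF A] by linarith
qed

text \<open>The displacement \<open>- lor x y\<close> is the hyperbolic cosine of the distance.\<close>

lemma H2_lor_ge_imp_eq:
  assumes "x \<in> H2" "y \<in> H2" "lor x y \<ge> -1"
  shows "x = y"
proof -
  define d where "d = y - x"
  have x: "lor x x = -1" "x$3 > 0" and y: "lor y y = -1" "y$3 > 0" using assms by (auto simp: H2_def)
  have d: "lor d d \<le> 0" "lor x d \<ge> 0" "lor y (-d) \<ge> 0"
    using assms(3) x y by (simp_all add: d_def lor_bilinear lor_commute[of y x])
  have "\<not> d$3 > 0" using lor_future_neg[of x d] x d by fastforce
  moreover have "\<not> (-d)$3 > 0" using lor_future_neg[of y "-d"] y d by (auto simp: lor_bilinear)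
  ultimately have "d$3 = 0" by simp
  then have "(d$1)\<^sup>2 + (d$2)\<^sup>2 \<le> 0" using d(1) by (simp add: lor_def power2_eq_square)
  then have "d$1 = 0 \<and> d$2 = 0" by (smt (verit) sum_power2_eq_zero_iff zero_le_power2)
  then have "d = 0" using \<open>d$3 = 0\<close> by (simp add: vec_eq_iff forall_3)
  then show ?thesis by (simp add: d_def)
qed

lemma H2_lor_le:
  assumes "x \<in> H2" "y \<in> H2"
  shows "lor x y \<le> -1"
  using H2_lor_ge_imp_eq[OF assms] assms by (cases "lor x y \<ge> -1") (auto simp: H2_def)

text \<open>The preimage of the image of an open set is the union of its translates.\<close>

lemma orbit_map_open:
  assumes G: "subgroup G SO21" and p: "orbit_homeo G S p" and U: "openin (top_of_set H2) U"
  shows "openin (top_of_set S) (p ` U)"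
proof -
  note G' = subgroup_SO21D[OF G]
  have q: "quotient_map (top_of_set H2) (top_of_set S) p"
    and orb: "\<And>x y. x \<in> H2 \<Longrightarrow> y \<in> H2 \<Longrightarrow> p x = p y \<longleftrightarrow> (\<exists>A\<in>G. y = A *v x)"
    using p by (auto simp: orbit_homeo_def)
  have UH: "U \<subseteq> H2" using U openin_imp_subset by blast
  have surj: "p ` H2 = S" using q by (simp add: quotient_map_def)
  have "{x \<in> H2. p x \<in> p ` U} = (\<Union>A\<in>G. {x \<in> H2. A *v x \<in> U})"
    using orb UH by auto blast+
  also have "openin (top_of_set H2) \<dots>"
  proof (intro openin_Union, clarify)
    fix A assume "A \<in> G"
    then have "openin (top_of_set H2) (H2 \<inter> (*v) A -` U)"
      using G'(1) SO21_H2 by (intro continuous_openin_preimage[OF _ _ U] matrix_vector_mult_linear_continuous_on) auto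
    moreover have "H2 \<inter> (*v) A -` U = {x \<in> H2. A *v x \<in> U}" by auto
    ultimately show "openin (top_of_set H2) {x \<in> H2. A *v x \<in> U}" by simp
  qed
  finally show ?thesis
    using q UH surj unfolding quotient_map_def by (auto dest!: spec[of _ "p ` U"])
qed

text \<open>Over a compact part of the quotient, an element without fixed points moves all points by a
  definite amount: otherwise conjugates of it, which lie in a bounded part of the discrete group,
  would have a fixed point in the limit.\<close>

lemma displacement_over_compact:
  assumes G: "subgroup G SO21" and disc: "discrete G" and p: "orbit_homeo G S p"
    and K: "compact K" "K \<subseteq> S" and A: "A \<in> G" and nofix: "\<And>x. x \<in> H2 \<Longrightarrow> A *v x \<noteq> x"
  shows "\<exists>\<delta>>0. \<forall>x\<in>H2. p x \<in> K \<longrightarrow> - lor x (A *v x) \<ge> 1 + \<delta>"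
proof (rule ccontr)
  note G' = subgroup_SO21D[OF G]
  have q: "quotient_map (top_of_set H2) (top_of_set S) p"
    and orb: "\<And>x y. x \<in> H2 \<Longrightarrow> y \<in> H2 \<Longrightarrow> p x = p y \<longleftrightarrow> (\<exists>A\<in>G. y = A *v x)"
    using p by (auto simp: orbit_homeo_def)
  have surj: "p ` H2 = S" using q by (simp add: quotient_map_def)
  assume neg: "\<not> ?thesis"
  have "\<exists>x. x \<in> H2 \<and> p x \<in> K \<and> - lor x (A *v x) < 1 + inverse (real (Suc n))" for n
  proof -
    have "inverse (real (Suc n)) > 0" by simp
    then show ?thesis using neg not_le by blast
  qed
  then obtain X where X: "\<And>n. X n \<in> H2" "\<And>n. p (X n) \<in> K"
    "\<And>n. - lor (X n) (A *v X n) < 1 + inverse (real (Suc n))" by metis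
  obtain y r where y: "y \<in> K" and r: "strict_mono r" and lim: "(p \<circ> X \<circ> r) \<longlonglongrightarrow> y"
    using K(1) X(2) unfolding compact_def by (metis comp_apply)
  obtain z where z: "z \<in> H2" "p z = y" using y K(2) surj by blast
  have "\<exists>c B. c \<in> H2 \<and> dist z c < inverse (real (Suc n)) \<and> B \<in> G \<and>
      - lor (B *v c) (A *v (B *v c)) < 1 + inverse (real (Suc n))" for n
  proof -
    let ?U = "H2 \<inter> ball z (inverse (real (Suc n)))"
    have "openin (top_of_set S) (p ` ?U)"
      by (rule orbit_map_open[OF G p]) (simp add: openin_open_Int)
    then obtain T where T: "open T" "p ` ?U = S \<inter> T" by (auto simp: openin_open)
    have "y \<in> p ` ?U" using z by force
    then have "y \<in> T" using T by blast
    then obtain N where N: "\<And>k. k \<ge> N \<Longrightarrow> p (X (r k)) \<in> T"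
      using topological_tendstoD[OF lim T(1)] by (auto simp: eventually_sequentially)
    define k where "k = max N n"
    have "p (X (r k)) \<in> p ` ?U" using N[of k] X(2)[of "r k"] K(2) T(2) by (auto simp: k_def)
    then obtain c where c: "c \<in> ?U" "p c = p (X (r k))" by auto
    then obtain B where B: "B \<in> G" "X (r k) = B *v c" using orb[of c "X (r k)"] X(1) by auto
    have "n \<le> r k" using seq_suble[OF r, of k] by (simp add: k_def)
    then have "inverse (real (Suc (r k))) \<le> inverse (real (Suc n))" by simp
    then have "- lor (X (r k)) (A *v X (r k)) < 1 + inverse (real (Suc n))"
      using X(3)[of "r k"] by linarith
    then show ?thesis using c B by auto
  qed
  then obtain c B where c: "\<And>n. c n \<in> H2" "\<And>n. dist z (c n) < inverse (real (Suc n))"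
    and B: "\<And>n. B n \<in> G"
    and cB: "\<And>n. - lor (B n *v c n) (A *v (B n *v c n)) < 1 + inverse (real (Suc n))" by metis
  define D where "D n = matrix_inv (B n) ** A ** B n" for n
  have DG: "D n \<in> G" for n using B A G' by (simp add: D_def)
  have D: "- lor (c n) (D n *v c n) < 1 + inverse (real (Suc n))" for n
    using cB[of n] lor_matrix_inv[OF G'(1)[OF B[of n]], of "A *v (B n *v c n)" "c n"]
    by (simp add: D_def lor_commute flip: matrix_vector_mul_assoc)
  have "norm (D n) \<le> 72 * (z$3 + 1)\<^sup>2 * 2" for n
  proof (rule SO21_norm_le_displacement[OF G'(1)[OF DG] c(1)])
    have i: "inverse (real (Suc n)) \<le> 1" by (simp add: field_simps)
    have "\<bar>(c n - z)$3\<bar> \<le> norm (c n - z)" by (rule component_le_norm_cart)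
    also have "\<dots> \<le> 1" using c(2)[of n] i by (simp add: dist_norm norm_minus_commute)
    finally show "c n $ 3 \<le> z$3 + 1" by simp
    show "- lor (c n) (D n *v c n) \<le> 2" using D[of n] i by linarith
  qed
  then have "bounded (range D)" by (auto simp: bounded_iff)
  then obtain s L where s: "strict_mono (s :: nat \<Rightarrow> nat)" and L: "L \<in> G" "\<And>n. D (s n) = L"
    using discrete_subgroup_bounded_sequence[where D = D, OF G disc DG] by blast
  have inv0: "(\<lambda>n. inverse (real (Suc n))) \<longlonglongrightarrow> 0" by (rule LIMSEQ_inverse_real_of_nat)
  have "(\<lambda>n. dist z (c n)) \<longlonglongrightarrow> 0"
    by (rule tendsto_sandwich[OF _ _ tendsto_const inv0])
       (intro always_eventually allI less_imp_le[OF c(2)] zero_le_dist)+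
  then have "c \<longlonglongrightarrow> z" by (simp add: tendsto_dist_iff[of c] dist_commute)
  then have cz: "(\<lambda>n. c (s n)) \<longlonglongrightarrow> z" using LIMSEQ_subseq_LIMSEQ[OF _ s] by (fastforce simp: o_def)
  have "(\<lambda>n. L *v c (s n)) \<longlonglongrightarrow> L *v z"
    using cz by (intro isCont_tendsto_compose[OF matrix_vector_mult_linear_continuous_at])
  then have l1: "(\<lambda>n. lor (c (s n)) (L *v c (s n))) \<longlonglongrightarrow> lor z (L *v z)"
    by (intro tendsto_lor cz)
  have l2: "(\<lambda>n. - (1 + inverse (real (Suc (s n))))) \<longlonglongrightarrow> - (1 + 0)"
    using LIMSEQ_subseq_LIMSEQ[OF inv0 s] by (intro tendsto_intros) (simp add: o_def)
  have "- (1 + inverse (real (Suc (s n)))) \<le> lor (c (s n)) (L *v c (s n))" for n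
    using D[of "s n"] L(2)[of n] by (simp del: of_nat_Suc)
  then have "- (1 + 0) \<le> lor z (L *v z)"
    by (intro LIMSEQ_le[OF l2 l1] exI[of _ 0] allI impI)
  then have "z = L *v z" using H2_lor_ge_imp_eq[OF z(1) SO21_H2[OF G'(1)[OF L(1)] z(1)]] by simp
  then have "B (s 0) *v z = B (s 0) *v (matrix_inv (B (s 0)) *v (A *v (B (s 0) *v z)))"
    unfolding L(2)[of 0, symmetric] D_def by (simp add: matrix_vector_mul_assoc matrix_mul_assoc)
  then have "A *v (B (s 0) *v z) = B (s 0) *v z"
    using matrix_inv_cancel(3)[OF G'(1)[OF B]] by simp
  then show False using nofix SO21_H2[OF G'(1)[OF B] z(1)] by blast
qed

text \<open>Far out towards a fixed null vector, an isometry moves points arbitrarily little, so a point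
  can be joined to its image by a short path. The chord of the hyperboloid, projected back to it,
  serves.\<close>

lemma short_path_near_fixed_null:
  assumes A: "A \<in> carrier SO21" and n: "lor n n = 0" "n$3 > 0" "A *v n = n" and \<delta>: "\<delta> > 0"
  shows "\<exists>\<gamma>. path \<gamma> \<and> path_image \<gamma> \<subseteq> H2 \<and> pathfinish \<gamma> = A *v pathstart \<gamma> \<and>
    (\<forall>x\<in>path_image \<gamma>. - lor x (A *v x) < 1 + \<delta>)"
proof -
  define e :: "real^3" where "e = axis 3 1"
  have e: "lor e e = -1" "e$3 > 0" by (simp_all add: e_def lor_def axis_def)
  define k where "k = - lor e n"
  have k: "k > 0" using n(2) by (simp add: k_def e_def lor_def axis_def)
  define d1 d2 where "d1 = - lor e (A *v e)" and "d2 = - lor e (A *v (A *v e))"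
  obtain s where s: "s > 0" "d1 - 1 < \<delta> * (1 + 2 * s * k)" "d2 - 1 < \<delta> * (1 + 2 * s * k)"
  proof
    \<comment> \<open>Any sufficiently large \<open>s\<close> will do.\<close>
    define s where "s = (\<bar>d1\<bar> + \<bar>d2\<bar> + 1) / (\<delta> * k)"
    show "s > 0" using k \<delta> by (simp add: s_def add_nonneg_pos)
    have "\<delta> * (1 + 2 * s * k) = \<delta> + 2 * (\<bar>d1\<bar> + \<bar>d2\<bar> + 1)" using k \<delta> by (simp add: s_def field_simps)
    then show "d1 - 1 < \<delta> * (1 + 2 * s * k)" "d2 - 1 < \<delta> * (1 + 2 * s * k)" using \<delta> by simp_all
  qed
  define q where "q = 1 + 2 * s * k"
  have q: "q > 0" using s k by (simp add: q_def add_pos_pos)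
  define x where "x = e + s *\<^sub>R n"
  have xx: "lor x x = - q" using e n by (simp add: x_def q_def k_def lor_bilinear lor_commute[of n e])
  have Ax: "A *v x = A *v e + s *\<^sub>R n" by (simp add: x_def matrix_vector_right_distrib matrix_vector_mult_scaleR n)
  have AAx: "A *v (A *v x) = A *v (A *v e) + s *\<^sub>R n"
    by (simp add: Ax matrix_vector_right_distrib matrix_vector_mult_scaleR n)
  have nA: "lor n (A *v e) = - k" "lor n (A *v (A *v e)) = - k"
    using SO21_lor[OF A, of n e] SO21_lor[OF A, of n "A *v e"] by (simp_all add: n k_def lor_commute)
  have x1: "- lor x (A *v x) = d1 + 2 * s * k"
    unfolding Ax by (simp add: x_def lor_bilinear n nA d1_def) (simp add: k_def algebra_simps)
  have x2: "- lor x (A *v (A *v x)) = d2 + 2 * s * k"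
    unfolding AAx by (simp add: x_def lor_bilinear n nA d2_def) (simp add: k_def algebra_simps)
  \<comment> \<open>Adding \<open>s n\<close> to \<open>e\<close> increases both \<open>- lor e (A *v e)\<close> and \<open>- lor e e\<close> by \<open>2 s k\<close>, so after
    rescaling to the hyperboloid the displacement is close to 1.\<close>
  define y where "y = (1 / sqrt q) *\<^sub>R x"
  have sq: "(1 / sqrt q) * (1 / sqrt q) = 1 / q" using q by (simp add: field_simps)
  have "lor y y = ((1 / sqrt q) * (1 / sqrt q)) * lor x x" by (simp add: y_def lor_bilinear)
  then have "lor y y = -1" using q by (simp add: sq xx)
  moreover have "y$3 > 0" using q e(2) n(2) s(1) by (simp add: y_def x_def add_pos_pos)
  ultimately have y: "y \<in> H2" by (simp add: H2_def)
  define c1 c2 where "c1 = - lor y (A *v y)" and "c2 = - lor y (A *v (A *v y))"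
  have "c1 = ((1 / sqrt q) * (1 / sqrt q)) * (- lor x (A *v x))"
    by (simp add: c1_def y_def lor_bilinear matrix_vector_mult_scaleR)
  then have "c1 = (d1 + 2 * s * k) / q" by (simp only: sq x1) simp
  then have c1: "c1 < 1 + \<delta>" using s(2) q by (simp add: divide_less_eq) (simp add: q_def algebra_simps)
  have "c2 = ((1 / sqrt q) * (1 / sqrt q)) * (- lor x (A *v (A *v x)))"
    by (simp add: c2_def y_def lor_bilinear matrix_vector_mult_scaleR)
  then have "c2 = (d2 + 2 * s * k) / q" by (simp only: sq x2) simp
  then have c2: "c2 < 1 + \<delta>" using s(3) q by (simp add: divide_less_eq) (simp add: q_def algebra_simps)
  have Ay: "A *v y \<in> H2" by (rule SO21_H2[OF A y])
  have c1': "c1 \<ge> 1" using H2_lor_le[OF y Ay] by (simp add: c1_def)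
  define w where "w t = (1 - t) *\<^sub>R y + t *\<^sub>R (A *v y)" for t
  have yy: "lor y y = -1" "y$3 > 0" "lor (A *v y) (A *v y) = -1" "(A *v y)$3 > 0"
    using y Ay by (auto simp: H2_def)
  define N where "N t = (1 - t)\<^sup>2 + t\<^sup>2 + 2 * t * (1 - t) * c1" for t
  have ww: "lor (w t) (w t) = - N t" for t
    unfolding w_def N_def by (simp add: lor_bilinear yy lor_commute[of "A *v y" y])
      (simp add: c1_def power2_eq_square algebra_simps)
  have wAw: "- lor (w t) (A *v w t) = ((1 - t)\<^sup>2 + t\<^sup>2) * c1 + t * (1 - t) * (c2 + 1)" for t
    unfolding w_def using SO21_lor[OF A, of y "A *v y"]
    by (simp add: lor_bilinear matrix_vector_right_distrib matrix_vector_mult_scaleR yy c1_def c2_def)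
      (simp add: power2_eq_square algebra_simps)
  have tt: "(1 - t)\<^sup>2 + t\<^sup>2 > 0" for t :: real
    by (cases "t = 0") (auto simp: add_nonneg_pos)
  have N: "N t > 0" if "t \<in> {0..1}" for t
    unfolding N_def by (rule add_pos_nonneg[OF tt]) (use that c1' in auto)
  define \<gamma> where "\<gamma> t = (1 / sqrt (N t)) *\<^sub>R w t" for t
  have H: "\<gamma> t \<in> H2" and small: "- lor (\<gamma> t) (A *v \<gamma> t) < 1 + \<delta>" if t: "t \<in> {0..1}" for t
  proof -
    have sqN: "(1 / sqrt (N t)) * (1 / sqrt (N t)) = 1 / N t" using N[OF t] by (simp add: field_simps)
    have "lor (\<gamma> t) (\<gamma> t) = ((1 / sqrt (N t)) * (1 / sqrt (N t))) * lor (w t) (w t)" by (simp add: \<gamma>_def lor_bilinear)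
    then have "lor (\<gamma> t) (\<gamma> t) = -1" using N[OF t] by (simp add: sqN ww)
    moreover have "w t $ 3 > 0"
    proof (cases "t = 0")
      case True then show ?thesis by (simp add: w_def yy)
    next
      case False then show ?thesis using t yy by (simp add: w_def add_nonneg_pos)
    qed
    then have "\<gamma> t $ 3 > 0" using N[OF t] by (simp add: \<gamma>_def)
    ultimately show "\<gamma> t \<in> H2" by (simp add: H2_def)
    have "((1 - t)\<^sup>2 + t\<^sup>2) * c1 < ((1 - t)\<^sup>2 + t\<^sup>2) * (1 + \<delta>)"
      using c1 tt[of t] by (rule mult_strict_left_mono)
    moreover have "t * (1 - t) * (c2 + 1) \<le> t * (1 - t) * (2 * c1 * (1 + \<delta>))"
    proof (rule mult_left_mono)
      have "1 * (1 + \<delta>) \<le> c1 * (1 + \<delta>)" using c1' \<delta> by (intro mult_right_mono) auto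
      then show "c2 + 1 \<le> 2 * c1 * (1 + \<delta>)" using c2 \<delta> by (simp add: algebra_simps)
    qed (use t in auto)
    ultimately have "- lor (w t) (A *v w t) < N t * (1 + \<delta>)"
      unfolding wAw N_def by (simp add: algebra_simps)
    moreover have "- lor (\<gamma> t) (A *v \<gamma> t) = ((1 / sqrt (N t)) * (1 / sqrt (N t))) * (- lor (w t) (A *v w t))"
      by (simp add: \<gamma>_def lor_bilinear matrix_vector_mult_scaleR)
    ultimately show "- lor (\<gamma> t) (A *v \<gamma> t) < 1 + \<delta>"
      using pos_divide_less_eq[OF N[OF t], of "- lor (w t) (A *v w t)" "1 + \<delta>"]
      unfolding sqN by (simp add: mult.commute)
  qed
  have "path \<gamma>"
    unfolding path_def \<gamma>_def w_def
  proof (intro continuous_intros ballI)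
    show "continuous_on {0..1} N" unfolding N_def by (intro continuous_intros)
    show "sqrt (N t) \<noteq> 0" if "t \<in> {0..1}" for t using N[OF that] by simp
  qed
  moreover have "path_image \<gamma> \<subseteq> H2" "\<forall>x\<in>path_image \<gamma>. - lor x (A *v x) < 1 + \<delta>"
    using H small by (auto simp: path_image_def)
  moreover have "pathfinish \<gamma> = A *v pathstart \<gamma>"
    by (simp add: pathfinish_def pathstart_def \<gamma>_def N_def w_def)
  ultimately show ?thesis by blast
qed

lemma finite_uniform_positive:
  fixes P :: "'a \<Rightarrow> real \<Rightarrow> bool"
  assumes "finite I" "\<And>i. i \<in> I \<Longrightarrow> \<exists>e>0. P i e" "\<And>i e e'. P i e \<Longrightarrow> 0 < e' \<Longrightarrow> e' \<le> e \<Longrightarrow> P i e'"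
  shows "\<exists>e>0. \<forall>i\<in>I. P i e"
proof -
  obtain f where f: "\<And>i. i \<in> I \<Longrightarrow> f i > 0 \<and> P i (f i)" using assms(2) by metis
  define e where "e = Min (insert 1 (f ` I))"
  have "e > 0" using assms(1) f by (simp add: e_def)
  moreover have "P i e" if "i \<in> I" for i
    using assms(3)[of i "f i" e] f[OF that] \<open>e > 0\<close> assms(1) that by (simp add: e_def)
  ultimately show ?thesis by blast
qed

text \<open>On the compact sphere, the larger of the two functions \<open>dist (c i) x - r i\<close> and
  \<open>dist (c j) x - r j\<close> is positive for disjoint caps and attains its minimum.\<close>

lemma disjoint_collars:
  assumes "disjoint_caps n c r"
  shows "\<exists>e>0. \<forall>i\<in>{1..n}. \<forall>j\<in>{1..n}. i \<noteq> j \<longrightarrow>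
    sphere 0 1 \<inter> ball (c i) (r i + e) \<inter> ball (c j) (r j + e) = {}"
proof -
  define P where "P = (\<lambda>(i, j) e. i \<noteq> j \<longrightarrow>
    sphere 0 1 \<inter> ball (c i) (r i + e) \<inter> ball (c j) (r j + e) = {})"
  have "\<exists>e>0. \<forall>ij\<in>{1..n} \<times> {1..n}. P ij e"
  proof (rule finite_uniform_positive)
    fix ij e e' assume "P ij e" "0 < e'" "e' \<le> e"
    then show "P ij e'" by (auto simp: P_def split: prod.splits)
  next
    fix ij assume "ij \<in> {1..n} \<times> {1..n}"
    then obtain i j where ij: "ij = (i, j)" "i \<in> {1..n}" "j \<in> {1..n}" by auto
    show "\<exists>e>0. P ij e"
    proof (cases "i = j")
      case True then show ?thesis by (auto simp: P_def ij intro: exI[of _ 1])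
    next
      case False
      define f where "f x = max (dist (c i) x - r i) (dist (c j) x - r j)" for x
      have "cap (c i) (r i) \<inter> cap (c j) (r j) = {}" using assms ij False by (auto simp: disjoint_caps_def)
      then have pos: "f x > 0" if "x \<in> sphere 0 1" for x
        using that by (auto simp: f_def cap_def max_def not_le)
      have "c i \<in> sphere 0 1" using assms ij by (auto simp: disjoint_caps_def)
      then obtain x where x: "x \<in> sphere 0 1" "\<And>y. y \<in> sphere 0 1 \<Longrightarrow> f x \<le> f y"
        using continuous_attains_inf[of "sphere 0 1 :: (real^3) set" f]
        unfolding f_def by (force intro: continuous_intros)
      have "P ij (f x)"
        using x(2) by (auto simp: P_def ij f_def) (smt (verit))
      then show ?thesis using pos[OF x(1)] by blast
    qed
  qed simp
  then show ?thesis by (auto simp: P_def)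
qed

text \<open>Cusps are peripheral: the short paths of a parabolic element leave every compact part of the
  quotient, hence lie in the collars of the boundary circles, and being connected in a single one.\<close>

lemma parabolic_peripheral:
  assumes G: "subgroup G SO21" and disc: "discrete G"
    and caps: "disjoint_caps n c r" and p: "orbit_homeo G (holed_sphere n c r) p"
    and A: "A \<in> G" and nofix: "\<And>x. x \<in> H2 \<Longrightarrow> A *v x \<noteq> x"
    and v: "lor v v = 0" "v$3 > 0" "A *v v = v"
  shows "\<exists>i\<in>{1..n}. homotopic_into_boundary p (c i) (r i) A"
proof (rule ccontr)
  let ?S = "holed_sphere n c r"
  let ?P = "\<lambda>i e. \<not> (\<exists>\<gamma>. path \<gamma> \<and> path_image \<gamma> \<subseteq> H2 \<and> pathfinish \<gamma> = A *v pathstart \<gamma> \<and>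
        p ` path_image \<gamma> \<subseteq> cball (c i) (r i + e))"
  assume "\<not> ?thesis"
  then have "\<exists>e>0. \<forall>i\<in>{1..n}. ?P i e"
  proof (intro finite_uniform_positive)
    fix i e e' assume "?P i e" "e' \<le> e"
    then show "?P i e'" using subset_cball[of "r i + e'" "r i + e" "c i"] by fastforce
  qed (auto simp: homotopic_into_boundary_def)
  then obtain e1 where e1: "e1 > 0" "\<And>i. i \<in> {1..n} \<Longrightarrow> ?P i e1" by blast
  obtain e0 where e0: "e0 > 0" "\<And>i j. i \<in> {1..n} \<Longrightarrow> j \<in> {1..n} \<Longrightarrow> i \<noteq> j \<Longrightarrow>
      sphere 0 1 \<inter> ball (c i) (r i + e0) \<inter> ball (c j) (r j + e0) = {}"
    using disjoint_collars[OF caps] by blast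
  define e where "e = min e0 e1"
  have e: "e > 0" "e \<le> e0" "e \<le> e1" using e0 e1 by (auto simp: e_def)
  define U where "U i = ball (c i) (r i + e)" for i
  define K where "K = sphere 0 1 - (\<Union>i\<in>{1..n}. U i)"
  have K: "compact K" unfolding K_def U_def by (intro compact_diff) auto
  have KS: "K \<subseteq> ?S" using e(1) by (auto simp: K_def U_def holed_sphere_def cap_def)
  obtain \<delta> where \<delta>: "\<delta> > 0" "\<And>x. x \<in> H2 \<Longrightarrow> p x \<in> K \<Longrightarrow> - lor x (A *v x) \<ge> 1 + \<delta>"
    using displacement_over_compact[OF G disc p K KS A nofix] by blast
  obtain \<gamma> where \<gamma>: "path \<gamma>" "path_image \<gamma> \<subseteq> H2" "pathfinish \<gamma> = A *v pathstart \<gamma>"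
    "\<And>x. x \<in> path_image \<gamma> \<Longrightarrow> - lor x (A *v x) < 1 + \<delta>"
    using short_path_near_fixed_null[OF subgroup_SO21D(1)[OF G A] v \<delta>(1)] by blast
  define Q where "Q = p ` path_image \<gamma>"
  have q: "quotient_map (top_of_set H2) (top_of_set ?S) p" using p by (simp add: orbit_homeo_def)
  then have "continuous_on H2 p" and surj: "p ` H2 = ?S"
    using quotient_imp_continuous_map[OF q] by (auto simp: quotient_map_def)
  then have conn: "connected Q"
    unfolding Q_def using \<gamma>(1,2) connected_path_image continuous_on_subset connected_continuous_image by metis
  have QS: "Q \<subseteq> sphere 0 1" using \<gamma>(2) surj by (auto simp: Q_def holed_sphere_def)
  have "Q \<inter> K = {}" using \<gamma>(2,4) \<delta>(2) unfolding Q_def by (smt (verit) disjoint_iff imageE subsetD)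
  then have cover: "Q \<subseteq> (\<Union>i\<in>{1..n}. U i)" using QS by (auto simp: K_def)
  have disj: "sphere 0 1 \<inter> U i \<inter> U j = {}" if "i \<in> {1..n}" "j \<in> {1..n}" "i \<noteq> j" for i j
    using e0(2)[OF that] subset_ball[of "r i + e" "r i + e0" "c i"] subset_ball[of "r j + e" "r j + e0" "c j"] e(2)
    unfolding U_def by auto
  have "p (pathstart \<gamma>) \<in> Q" unfolding Q_def by (intro imageI pathstart_in_path_image)
  then obtain i where i: "i \<in> {1..n}" "p (pathstart \<gamma>) \<in> U i" using cover by blast
  define V where "V = (\<Union>j\<in>{1..n} - {i}. U j)"
  have "Q \<subseteq> U i \<union> V" using cover by (auto simp: V_def)
  moreover have "U i \<inter> V \<inter> Q = {}" using disj[OF i(1)] QS unfolding V_def by blast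
  moreover have "open (U i)" "open V" by (auto simp: U_def V_def)
  ultimately have "U i \<inter> Q = {} \<or> V \<inter> Q = {}" using connectedD[OF conn] by blast
  then have "Q \<subseteq> U i" using i(2) \<open>p (pathstart \<gamma>) \<in> Q\<close> \<open>Q \<subseteq> U i \<union> V\<close> by blast
  then have "Q \<subseteq> cball (c i) (r i + e1)" using e(3) by (auto simp: U_def)
  then show False using e1(2)[OF i(1)] \<gamma>(1-3) unfolding Q_def by blast
qed

lemma mprod_append: "mprod (xs @ ys) = mprod xs ** mprod ys"
  by (induction xs) (auto simp: mprod_def matrix_mul_assoc)

lemma mprod_simps [simp]: "mprod [] = mat 1" "mprod (A # As) = A ** mprod As"
  by (simp_all add: mprod_def)

text \<open>The powers of an isometry with a fixed point are bounded, so in a discrete group two of them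
  coincide.\<close>

lemma elliptic_finite_order:
  assumes G: "subgroup G SO21" and disc: "discrete G" and A: "A \<in> G" and x: "x \<in> H2" "A *v x = x"
  shows "\<exists>m\<ge>1. mprod (replicate m A) = mat 1"
proof -
  note G' = subgroup_SO21D[OF G]
  define D where "D m = mprod (replicate m A)" for m
  have D: "D m \<in> G" for m by (induction m) (use A G' in \<open>auto simp: D_def\<close>)
  have fixed: "D m *v x = x" for m
    by (induction m) (auto simp: D_def x simp flip: matrix_vector_mul_assoc)
  have "norm (D m) \<le> 72 * (x$3)\<^sup>2 * 1" for m
    by (rule SO21_norm_le_displacement[OF G'(1)[OF D] x(1)]) (use x(1) in \<open>auto simp: fixed H2_def\<close>)
  then have "bounded (range D)" by (auto simp: bounded_iff)
  then obtain r L where r: "strict_mono r" and L: "\<And>n::nat. D (r n) = L"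
    using discrete_subgroup_bounded_sequence[where D = D, OF G disc D] by blast
  define m where "m = r 1 - r 0"
  have m: "m \<ge> 1" "r 1 = r 0 + m" using strict_monoD[OF r, of 0 1] by (auto simp: m_def)
  have "L ** D m = L" using L[of 0] L[of 1] unfolding m(2) D_def by (simp add: replicate_add mprod_append)
  moreover have "L \<in> carrier SO21" using G'(1)[OF D] L by metis
  ultimately have "D m = mat 1" by (metis matrix_inv_cancel(2) matrix_mul_assoc matrix_mul_lid)
  then show ?thesis using m(1) by (auto simp: D_def)
qed

lemma infinite_order_hyperbolic:
  assumes G: "subgroup G SO21" and disc: "discrete G"
    and caps: "disjoint_caps n c r" and p: "orbit_homeo G (holed_sphere n c r) p"
    and per: "\<And>A i. A \<in> G \<Longrightarrow> i \<in> {1..n} \<Longrightarrow> A \<noteq> mat 1 \<Longrightarrow>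
      homotopic_into_boundary p (c i) (r i) A \<Longrightarrow> hyperbolic A"
    and A: "A \<in> G" and inf: "\<And>m. m \<ge> 1 \<Longrightarrow> mprod (replicate m A) \<noteq> mat 1"
  shows "hyperbolic A"
proof -
  have nofix: "A *v x \<noteq> x" if "x \<in> H2" for x
    using elliptic_finite_order[OF G disc A that] inf by blast
  have "A \<noteq> mat 1" using inf[of 1] by simp
  then show ?thesis
    using SO21_trichotomy[OF subgroup_SO21D(1)[OF G A]] nofix
      parabolic_peripheral[OF G disc caps p A nofix] per[OF A] by blast
qed

section \<open>Cocycles on free groups\<close>

definition letter_val :: "(nat \<Rightarrow> real^3^3) \<Rightarrow> nat \<times> bool \<Rightarrow> real^3^3" where
  "letter_val g x = (if snd x then g (fst x) else matrix_inv (g (fst x)))"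

lemma word_val_simps [simp]:
  "word_val g [] = mat 1"
  "word_val g (x # w) = letter_val g x ** word_val g w"
  "word_val g (w @ w') = word_val g w ** word_val g w'"
  by (simp_all add: word_val_def letter_val_def mprod_append split: prod.splits)

text \<open>The value forced on a word by the cocycle identity and the values \<open>v\<close> on the letters.\<close>

primrec word_cocycle :: "(nat \<Rightarrow> real^3^3) \<Rightarrow> (nat \<Rightarrow> real^3) \<Rightarrow> (nat \<times> bool) list \<Rightarrow> real^3" where
  "word_cocycle g v [] = 0"
| "word_cocycle g v (x # w) = letter_val g x *v word_cocycle g v w +
     (if snd x then v (fst x) else - (matrix_inv (g (fst x)) *v v (fst x)))"

lemma word_cocycle_append:
  "word_cocycle g v (w @ w') = word_val g w *v word_cocycle g v w' + word_cocycle g v w"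
  by (induction w) (auto simp: matrix_vector_right_distrib matrix_vector_mul_assoc)

definition inverse_word :: "(nat \<times> bool) list \<Rightarrow> (nat \<times> bool) list" where
  "inverse_word w = rev (map (\<lambda>x. (fst x, \<not> snd x)) w)"

lemma fst_set_inverse_word [simp]: "fst ` set (inverse_word w) = fst ` set w"
  by (simp add: inverse_word_def image_image)

lemma letter_val_carrier:
  assumes "g ` J \<subseteq> carrier SO21" "fst x \<in> J"
  shows "letter_val g x \<in> carrier SO21"
  using assms SO21_matrix_inv by (auto simp: letter_val_def)

lemma word_val_carrier:
  assumes "g ` J \<subseteq> carrier SO21" "fst ` set w \<subseteq> J"
  shows "word_val g w \<in> carrier SO21"
  using assms(2) by (induction w) (auto simp: SO21_one intro!: SO21_mult letter_val_carrier[OF assms(1)])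

lemma letter_val_cancel:
  assumes "g ` J \<subseteq> carrier SO21" "i \<in> J"
  shows "letter_val g (i, s) ** letter_val g (i, \<not> s) = mat 1"
  using matrix_inv_cancel[of "g i"] assms by (auto simp: letter_val_def)

lemma word_val_inverse_word:
  assumes "g ` J \<subseteq> carrier SO21" "fst ` set w \<subseteq> J"
  shows "word_val g (inverse_word w) ** word_val g w = mat 1"
  using assms(2)
proof (induction w)
  case (Cons x w)
  obtain i s where x: "x = (i, s)" by (cases x)
  have c: "letter_val g (i, \<not> s) ** letter_val g (i, s) = mat 1"
    using letter_val_cancel[OF assms(1), of i "\<not> s"] Cons.prems x by simp
  have "word_val g (inverse_word (x # w)) ** word_val g (x # w) =
      word_val g (inverse_word w) ** (letter_val g (i, \<not> s) ** letter_val g (i, s)) ** word_val g w"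
    by (simp add: inverse_word_def x matrix_mul_assoc)
  also have "\<dots> = mat 1" using Cons by (simp add: c)
  finally show ?case .
qed (simp add: inverse_word_def)

lemma not_successively_split:
  "\<not> successively P w \<Longrightarrow> \<exists>xs x y ys. w = xs @ x # y # ys \<and> \<not> P x y"
proof (induction w rule: induct_list012)
  case (3 x y zs)
  show ?case
  proof (cases "P x y")
    case True
    then obtain xs x' y' ys where "y # zs = xs @ x' # y' # ys" "\<not> P x' y'" using 3 by auto
    then have "x # y # zs = (x # xs) @ x' # y' # ys \<and> \<not> P x' y'" by simp
    then show ?thesis by blast
  next
    case False
    then have "x # y # zs = [] @ x # y # zs \<and> \<not> P x y" by simp
    then show ?thesis by blast
  qed
qed auto

text \<open>Freeness turns a relation into a chain of cancellations of adjacent inverse letters, none of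
  which changes the value of the cocycle.\<close>

lemma word_cocycle_relation:
  assumes g: "g ` J \<subseteq> carrier SO21" and free: "freely_independent J g"
  shows "fst ` set w \<subseteq> J \<Longrightarrow> word_val g w = mat 1 \<Longrightarrow> word_cocycle g v w = 0"
proof (induction "length w" arbitrary: w rule: less_induct)
  case less
  show ?case
  proof (cases "w = []")
    case False
    then have "\<not> reduced w" using free less.prems unfolding freely_independent_def by blast
    then obtain xs x y ys where w: "w = xs @ x # y # ys" and xy: "fst x = fst y" "snd x \<noteq> snd y"
      using not_successively_split unfolding reduced_def by blast
    have y: "y = (fst x, \<not> snd x)" using xy by (cases y) auto
    have i: "fst x \<in> J" using less.prems(1) w by simp
    have canc: "letter_val g x ** letter_val g y = mat 1"
      using letter_val_cancel[OF g i, of "snd x"] y by simp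
    have "word_val g w = word_val g xs ** (letter_val g x ** letter_val g y) ** word_val g ys"
      by (simp add: w matrix_mul_assoc)
    then have "word_val g (xs @ ys) = mat 1" using less.prems(2) by (simp add: canc)
    then have IH: "word_cocycle g v (xs @ ys) = 0" using less.hyps less.prems(1) w by simp
    have gi: "g (fst x) \<in> carrier SO21" using g i by blast
    have "word_cocycle g v (x # y # ys) = word_cocycle g v ys"
      using matrix_inv_cancel[OF gi]
      by (simp add: y letter_val_def matrix_vector_right_distrib matrix_vector_minus)
    then have "word_cocycle g v w = word_cocycle g v (xs @ ys)"
      by (simp add: w word_cocycle_append del: word_cocycle.simps)
    then show ?thesis using IH by simp
  qed simp
qed

lemma word_cocycle_well_defined:
  assumes g: "g ` J \<subseteq> carrier SO21" and free: "freely_independent J g"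
    and w: "fst ` set w \<subseteq> J" "fst ` set w' \<subseteq> J" and eq: "word_val g w = word_val g w'"
  shows "word_cocycle g v w = word_cocycle g v w'"
proof -
  let ?i = "inverse_word w"
  have one: "word_val g ?i ** word_val g w = mat 1" by (rule word_val_inverse_word[OF g w(1)])
  have "word_cocycle g v (?i @ w) = 0" "word_cocycle g v (?i @ w') = 0"
    by (rule word_cocycle_relation[OF g free]; use w one eq in \<open>auto simp: image_Un\<close>)+
  then have "word_val g ?i *v word_cocycle g v w = word_val g ?i *v word_cocycle g v w'"
    by (simp add: word_cocycle_append) (metis add_right_cancel)
  moreover have "word_val g ?i \<in> carrier SO21" using word_val_carrier[OF g] w(1) by simp
  ultimately show ?thesis by (metis matrix_inv_cancel(4))
qed

lemma generate_words:
  assumes g: "g ` J \<subseteq> carrier SO21"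
  shows "generate SO21 (g ` J) = word_val g ` {w. fst ` set w \<subseteq> J}"
proof (intro equalityI subsetI)
  fix A assume "A \<in> generate SO21 (g ` J)"
  then show "A \<in> word_val g ` {w. fst ` set w \<subseteq> J}"
  proof induction
    case one
    show ?case by (rule image_eqI[of _ _ "[]"]) (auto simp: SO21_one_eq)
  next
    case (incl h)
    then obtain i where "i \<in> J" "h = g i" by blast
    then show ?case by (intro image_eqI[of _ _ "[(i, True)]"]) (auto simp: letter_val_def)
  next
    case (inv h)
    then obtain i where i: "i \<in> J" "h = g i" by blast
    then have "h \<in> carrier SO21" using g by blast
    then show ?case using i
      by (intro image_eqI[of _ _ "[(i, False)]"]) (auto simp: letter_val_def SO21_inv_eq)
  next
    case (eng h1 h2)
    then obtain w1 w2 where "h1 = word_val g w1" "h2 = word_val g w2" "fst ` set w1 \<subseteq> J" "fst ` set w2 \<subseteq> J"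
      by auto
    then show ?case by (intro image_eqI[of _ _ "w1 @ w2"]) (auto simp: SO21_mult_eq)
  qed
next
  fix A assume "A \<in> word_val g ` {w. fst ` set w \<subseteq> J}"
  then obtain w where w: "A = word_val g w" "fst ` set w \<subseteq> J" by blast
  note sub = subgroup_SO21D[OF group.generate_is_subgroup[OF group_SO21 g]]
  have "letter_val g x \<in> generate SO21 (g ` J)" if "fst x \<in> J" for x
    using that generate.incl[of "g (fst x)" "g ` J" SO21] sub(4) by (auto simp: letter_val_def)
  then show "A \<in> generate SO21 (g ` J)"
    unfolding w(1) using w(2) by (induction w) (auto intro: sub)
qed

text \<open>The value at a group element is read off from any word for it, and freeness makes the choice of
  the word irrelevant.\<close>

lemma cocycle_exists:
  assumes g: "g ` J \<subseteq> carrier SO21" and free: "freely_independent J g"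
    and G: "G = generate SO21 (g ` J)"
  shows "\<exists>u\<in>Z1 G. \<forall>i\<in>J. u (g i) = v i"
proof -
  have Gw: "G = word_val g ` {w. fst ` set w \<subseteq> J}" using G generate_words[OF g] by simp
  define word where "word A = (SOME w. fst ` set w \<subseteq> J \<and> word_val g w = A)" for A
  have word: "fst ` set (word A) \<subseteq> J" "word_val g (word A) = A" if "A \<in> G" for A
    using someI_ex[of "\<lambda>w. fst ` set w \<subseteq> J \<and> word_val g w = A"] that
    unfolding word_def[symmetric] Gw by auto
  define u where "u A = (if A \<in> G then word_cocycle g v (word A) else 0)" for A
  have u: "u (word_val g w) = word_cocycle g v w" if "fst ` set w \<subseteq> J" for w
  proof -
    have "word_val g w \<in> G" using that Gw by blast
    then show ?thesis
      using word_cocycle_well_defined[OF g free word(1) that word(2)] by (simp add: u_def)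
  qed
  have "u (A ** B) = A *v u B + u A" if AB: "A \<in> G" "B \<in> G" for A B
  proof -
    have "u (word_val g (word A @ word B)) = word_cocycle g v (word A @ word B)"
      by (rule u) (use word(1)[OF AB(1)] word(1)[OF AB(2)] in auto)
    then show ?thesis
      using AB by (simp add: word word_cocycle_append) (simp add: u_def)
  qed
  then have "u \<in> Z1 G" by (auto simp: Z1_def u_def)
  moreover have "u (g i) = v i" if "i \<in> J" for i
    using u[of "[(i, True)]"] that by (simp add: letter_val_def)
  ultimately show ?thesis by blast
qed

lemma Z1_mult: "u \<in> Z1 G \<Longrightarrow> A \<in> G \<Longrightarrow> B \<in> G \<Longrightarrow> u (A ** B) = A *v u B + u A"
  by (simp add: Z1_def)

lemma Z1_one: "u \<in> Z1 G \<Longrightarrow> mat 1 \<in> G \<Longrightarrow> u (mat 1) = 0"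
  using Z1_mult[of u G "mat 1" "mat 1"] by simp

lemma Z1_inv:
  assumes "subgroup G SO21" "u \<in> Z1 G" "A \<in> G"
  shows "u (matrix_inv A) = - (matrix_inv A *v u A)"
proof -
  note G = subgroup_SO21D[OF assms(1)]
  have "u (matrix_inv A ** A) = matrix_inv A *v u A + u (matrix_inv A)"
    by (rule Z1_mult[OF assms(2) G(4)[OF assms(3)] assms(3)])
  then show ?thesis
    using Z1_one[OF assms(2) G(2)] matrix_inv_cancel(2)[OF G(1)[OF assms(3)]]
    by (simp add: eq_neg_iff_add_eq_0 add.commute)
qed

lemma Z1_add: "u \<in> Z1 G \<Longrightarrow> w \<in> Z1 G \<Longrightarrow> (\<lambda>A. u A + w A) \<in> Z1 G"
  by (auto simp: Z1_def matrix_vector_right_distrib)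

lemma Z1_diff: "u \<in> Z1 G \<Longrightarrow> w \<in> Z1 G \<Longrightarrow> (\<lambda>A. u A - w A) \<in> Z1 G"
  by (auto simp: Z1_def matrix_vector_mult_diff_distrib)

lemma Z1_scale: "u \<in> Z1 G \<Longrightarrow> (\<lambda>A. a *\<^sub>R u A) \<in> Z1 G"
  by (auto simp: Z1_def matrix_vector_mult_scaleR scaleR_add_right)

lemma Z1_zero: "(\<lambda>A. 0) \<in> Z1 G"
  by (auto simp: Z1_def)

lemma Z1_sum: "(\<And>k. k \<in> K \<Longrightarrow> u k \<in> Z1 G) \<Longrightarrow> (\<lambda>A. \<Sum>k\<in>K. u k A) \<in> Z1 G"
  by (induction K rule: infinite_finite_induct) (auto simp: Z1_zero Z1_add)

lemma coboundary_Z1: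
  assumes "subgroup G SO21"
  shows "coboundary G v \<in> Z1 G"
  using subgroup_SO21D(3)[OF assms]
  by (auto simp: Z1_def coboundary_def matrix_vector_mult_diff_distrib matrix_vector_mul_assoc)

lemma coboundary_add: "coboundary G (v + w) = (\<lambda>A. coboundary G v A + coboundary G w A)"
  and coboundary_diff: "coboundary G (v - w) = (\<lambda>A. coboundary G v A - coboundary G w A)"
  and coboundary_scale: "coboundary G (a *\<^sub>R v) = (\<lambda>A. a *\<^sub>R coboundary G v A)"
  by (auto simp: coboundary_def fun_eq_iff matrix_vector_right_distrib matrix_vector_mult_diff_distrib
      matrix_vector_mult_scaleR algebra_simps)

lemma Z1_zero_on_generate:
  assumes G: "subgroup G SO21" and u: "u \<in> Z1 G" and S: "S \<subseteq> G" "\<And>A. A \<in> S \<Longrightarrow> u A = 0"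
    and A: "A \<in> generate SO21 S"
  shows "A \<in> G \<and> u A = 0"
  using A
proof induction
  note G' = subgroup_SO21D[OF G]
  case one
  then show ?case using G'(2) Z1_one[OF u] by (simp add: SO21_one_eq)
next
  case (incl h)
  then show ?case using S by blast
next
  note G' = subgroup_SO21D[OF G]
  case (inv h)
  then have h: "h \<in> G" "u h = 0" using S by blast+
  then show ?case using G'(4) Z1_inv[OF G u] by (simp add: SO21_inv_eq[OF G'(1)])
next
  note G' = subgroup_SO21D[OF G]
  case (eng h1 h2)
  then show ?case using G'(3) Z1_mult[OF u] by (simp add: SO21_mult_eq)
qed

lemma Z1_eq_on_generate:
  assumes G: "subgroup G SO21" and u: "u \<in> Z1 G" "w \<in> Z1 G"
    and S: "S \<subseteq> G" "\<And>A. A \<in> S \<Longrightarrow> u A = w A" and A: "A \<in> generate SO21 S"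
  shows "u A = w A"
  using Z1_zero_on_generate[OF G Z1_diff[OF u] S(1) _ A] S(2) by simp

lemma margulis_add: "margulis (\<lambda>A. u A + w A) A = margulis u A + margulis w A"
  and margulis_diff: "margulis (\<lambda>A. u A - w A) A = margulis u A - margulis w A"
  and margulis_scale: "margulis (\<lambda>A. a *\<^sub>R u A) A = a * margulis u A"
  by (simp_all add: margulis_def lor_bilinear)

lemma lor_sum_left: "lor (\<Sum>k\<in>K. f k) y = (\<Sum>k\<in>K. lor (f k) y)"
  by (induction K rule: infinite_finite_induct) (auto simp: lor_bilinear)

lemma margulis_coboundary:
  assumes "hyperbolic A"
  shows "lor (v - A *v v) (X0 A) = 0"
  using SO21_lor[OF hyperbolic_eig(1)[OF assms], of v "X0 A"] hyperbolic_X0(1)[OF assms]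
  by (simp add: lor_bilinear)

lemma lor_coboundary_Xp:
  assumes "hyperbolic A"
  shows "lor (v - A *v v) (Xp A) = (1 - eig A) * lor v (Xp A)"
  using SO21_lor[OF hyperbolic_eig(1)[OF assms], of v "Xp A"] hyperbolic_Xm_Xp(4)[OF assms]
    hyperbolic_eig(2)[OF assms]
  by (simp add: lor_bilinear field_simps)

lemma lor_coboundary_Xm:
  assumes "hyperbolic A"
  shows "lor (v - A *v v) (Xm A) = (1 - 1 / eig A) * lor v (Xm A)"
  using SO21_lor[OF hyperbolic_eig(1)[OF assms], of v "Xm A"] hyperbolic_Xm_Xp(1)[OF assms]
    hyperbolic_eig(2)[OF assms]
  by (simp add: lor_bilinear field_simps)

lemma reduced_power:
  assumes "reduced (w @ w)"
  shows "reduced (concat (replicate m w))"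
proof (cases "w = []")
  case True
  then show ?thesis by (induction m) (auto simp: reduced_def)
next
  case False
  have hd: "concat (replicate m w) \<noteq> [] \<Longrightarrow> hd (concat (replicate m w)) = hd w" for m
    using False by (cases m) auto
  show ?thesis
  proof (induction m)
    case (Suc m)
    then show ?case using assms hd[of m] False
      by (auto simp: reduced_def successively_append_iff)
  qed (simp add: reduced_def)
qed

text \<open>The powers of a cyclically reduced word are reduced.\<close>

lemma free_infinite_order:
  assumes free: "freely_independent J g" and w: "w \<noteq> []" "fst ` set w \<subseteq> J" "reduced (w @ w)" and m: "m \<ge> 1"
  shows "mprod (replicate m (word_val g w)) \<noteq> mat 1"
proof -
  have eq: "word_val g (concat (replicate m w)) = mprod (replicate m (word_val g w))" for m
    by (induction m) auto
  have "concat (replicate m w) \<noteq> []" using w(1) m by (cases m) auto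
  moreover have "fst ` set (concat (replicate m w)) \<subseteq> J" using w(2) by force
  ultimately show ?thesis
    using free reduced_power[OF w(3), of m] unfolding freely_independent_def eq[symmetric] by blast
qed

lemma reduced_constant_sign:
  assumes "\<And>x. x \<in> set w \<Longrightarrow> snd x = s"
  shows "reduced w"
  using assms unfolding reduced_def by (induction w rule: induct_list012) auto

text \<open>Solutions vanish outside the index range, as parameter families are required to do.\<close>

lemma triangular_system_solvable:
  fixes a :: "nat \<Rightarrow> nat \<Rightarrow> real"
  assumes "\<And>k. k \<in> {1..n} \<Longrightarrow> a k k \<noteq> 0" "\<And>k i. 1 \<le> i \<Longrightarrow> i < k \<Longrightarrow> k \<le> n \<Longrightarrow> a k i = 0"
  shows "\<exists>t. (\<forall>k. k \<notin> {1..n} \<longrightarrow> t k = 0) \<and> (\<forall>i\<in>{1..n}. (\<Sum>k=1..n. t k * a k i) = c i)"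
  using assms
proof (induction n)
  case 0
  then show ?case by (intro exI[of _ "\<lambda>_. 0"]) auto
next
  case (Suc n)
  then obtain t where t: "\<And>k. k \<notin> {1..n} \<Longrightarrow> t k = 0" "\<And>i. i \<in> {1..n} \<Longrightarrow> (\<Sum>k=1..n. t k * a k i) = c i"
    by force
  define s where "s = (c (Suc n) - (\<Sum>k=1..n. t k * a k (Suc n))) / a (Suc n) (Suc n)"
  define t' where "t' = t(Suc n := s)"
  have split: "(\<Sum>k=1..Suc n. t' k * a k i) = (\<Sum>k=1..n. t k * a k i) + s * a (Suc n) i" for i
    by (simp add: t'_def)
  have "(\<Sum>k=1..Suc n. t' k * a k i) = c i" if "i \<in> {1..Suc n}" for i
  proof (cases "i = Suc n")
    case True
    then show ?thesis unfolding split using Suc.prems(1)[of "Suc n"] by (simp add: s_def)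
  next
    case False
    then show ?thesis unfolding split using Suc.prems(2)[of i "Suc n"] t(2)[of i] that by simp
  qed
  moreover have "t' k = 0" if "k \<notin> {1..Suc n}" for k using that t(1) by (auto simp: t'_def)
  ultimately show ?case by blast
qed

lemma triangular_system_unique:
  fixes a :: "nat \<Rightarrow> nat \<Rightarrow> real"
  assumes "\<And>k. k \<in> {1..n} \<Longrightarrow> a k k \<noteq> 0" "\<And>k i. 1 \<le> i \<Longrightarrow> i < k \<Longrightarrow> k \<le> n \<Longrightarrow> a k i = 0"
    and "\<And>i. i \<in> {1..n} \<Longrightarrow> (\<Sum>k=1..n. t k * a k i) = 0"
  shows "i \<in> {1..n} \<Longrightarrow> t i = 0"
proof (induction i rule: less_induct)
  case (less i)
  have "(\<Sum>k=1..n. t k * a k i) = (\<Sum>k\<in>{i}. t k * a k i)"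
  proof (rule sum.mono_neutral_right)
    show "\<forall>k\<in>{1..n} - {i}. t k * a k i = 0"
    proof
      fix k assume k: "k \<in> {1..n} - {i}"
      then consider "k < i" | "i < k" by force
      then show "t k * a k i = 0" by cases (use k less assms(2) in auto)
    qed
  qed (use less in auto)
  then show ?case using assms(1,3)[OF less.prems] by simp
qed

lemma cohom_class_self: "u \<in> Z1 G \<Longrightarrow> u \<in> cohom_class G u"
proof -
  have "coboundary G 0 = (\<lambda>A. u A - u A)" by (simp add: coboundary_def fun_eq_iff)
  then show "u \<in> Z1 G \<Longrightarrow> u \<in> cohom_class G u" by (auto simp: cohom_class_def intro: exI[of _ 0])
qed

lemma cohom_class_eq:
  assumes G: "subgroup G SO21" and u: "u \<in> Z1 G" "w \<in> Z1 G"
  shows "cohom_class G u = cohom_class G w \<longleftrightarrow> (\<exists>v. (\<lambda>A. w A - u A) = coboundary G v)"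
proof
  assume "cohom_class G u = cohom_class G w"
  then have "w \<in> cohom_class G u" using cohom_class_self[OF u(2)] by simp
  then show "\<exists>v. (\<lambda>A. w A - u A) = coboundary G v" by (simp add: cohom_class_def)
next
  assume "\<exists>v. (\<lambda>A. w A - u A) = coboundary G v"
  then obtain v where v: "\<And>A. w A - u A = coboundary G v A" by (metis (no_types))
  have "(\<exists>v. (\<lambda>A. x A - u A) = coboundary G v) \<longleftrightarrow> (\<exists>v. (\<lambda>A. x A - w A) = coboundary G v)" for x
  proof
    assume "\<exists>v. (\<lambda>A. x A - u A) = coboundary G v"
    then obtain v' where v': "\<And>A. x A - u A = coboundary G v' A" by (metis (no_types))
    have "(\<lambda>A. x A - w A) = coboundary G (v' - v)"
      unfolding coboundary_diff using v v' by (simp add: fun_eq_iff flip: v v')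
    then show "\<exists>v. (\<lambda>A. x A - w A) = coboundary G v" by blast
  next
    assume "\<exists>v. (\<lambda>A. x A - w A) = coboundary G v"
    then obtain v' where v': "\<And>A. x A - w A = coboundary G v' A" by (metis (no_types))
    have "(\<lambda>A. x A - u A) = coboundary G (v' + v)"
      unfolding coboundary_add using v v' by (simp add: fun_eq_iff flip: v v')
    then show "\<exists>v. (\<lambda>A. x A - u A) = coboundary G v" by blast
  qed
  then show "cohom_class G u = cohom_class G w" by (auto simp: cohom_class_def)
qed

lemma cohom_classD:
  assumes "w \<in> cohom_class G u"
  shows "w \<in> Z1 G" "\<exists>v. \<forall>A. w A = u A + coboundary G v A"
  using assms by (auto simp: cohom_class_def fun_eq_iff algebra_simps)

lemma H1_add_class:
  assumes G: "subgroup G SO21" and u: "u \<in> Z1 G" "w \<in> Z1 G"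
  shows "H1_add G (cohom_class G u) (cohom_class G w) = cohom_class G (\<lambda>A. u A + w A)"
proof -
  have "cohom_class G (\<lambda>A. u' A + w' A) = cohom_class G (\<lambda>A. u A + w A)"
    if u': "u' \<in> cohom_class G u" and w': "w' \<in> cohom_class G w" for u' w'
  proof -
    obtain v v' where "\<And>A. u' A = u A + coboundary G v A" "\<And>A. w' A = w A + coboundary G v' A"
      using cohom_classD(2)[OF u'] cohom_classD(2)[OF w'] by blast
    then have "(\<lambda>A. (u' A + w' A) - (u A + w A)) = coboundary G (v + v')"
      unfolding coboundary_add by (simp add: fun_eq_iff)
    then show ?thesis
      using cohom_class_eq[OF G Z1_add[OF u] Z1_add[OF cohom_classD(1)[OF u'] cohom_classD(1)[OF w']]] by metis
  qed
  then show ?thesis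
    unfolding H1_add_def using cohom_class_self[OF u(1)] cohom_class_self[OF u(2)] by blast
qed

lemma H1_scale_class:
  assumes G: "subgroup G SO21" and u: "u \<in> Z1 G"
  shows "H1_scale G a (cohom_class G u) = cohom_class G (\<lambda>A. a *\<^sub>R u A)"
proof -
  have "cohom_class G (\<lambda>A. a *\<^sub>R u' A) = cohom_class G (\<lambda>A. a *\<^sub>R u A)"
    if u': "u' \<in> cohom_class G u" for u'
  proof -
    obtain v where "\<And>A. u' A = u A + coboundary G v A" using cohom_classD(2)[OF u'] by blast
    then have "(\<lambda>A. a *\<^sub>R u' A - a *\<^sub>R u A) = coboundary G (a *\<^sub>R v)"
      unfolding coboundary_scale by (simp add: fun_eq_iff scaleR_add_right)
    then have "cohom_class G (\<lambda>A. a *\<^sub>R u A) = cohom_class G (\<lambda>A. a *\<^sub>R u' A)"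
      unfolding cohom_class_eq[OF G Z1_scale[OF u] Z1_scale[OF cohom_classD(1)[OF u']]] by blast
    then show ?thesis by simp
  qed
  then show ?thesis unfolding H1_scale_def using cohom_class_self[OF u] by blast
qed

section \<open>The parametrisation\<close>

locale holed_sphere_holonomy =
  fixes b :: nat and g :: "nat \<Rightarrow> real^3^3"
  assumes b: "b \<ge> 3" and hol: "holonomy_generators b g"
begin

abbreviation "G \<equiv> Gb b g"
abbreviation "h \<equiv> hcurve g"

lemma g_carrier: "i \<in> {1..b+1} \<Longrightarrow> g i \<in> carrier SO21"
  using hol by (auto simp: holonomy_generators_def)

lemma basis_carrier: "g ` {1..b} \<subseteq> carrier SO21"
  using g_carrier by auto

lemma subgroup_G: "subgroup G SO21"
  unfolding Gb_def using g_carrier by (intro group.generate_is_subgroup[OF group_SO21]) auto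

lemmas G = subgroup_SO21D[OF subgroup_G]

lemma g_in_G: "i \<in> {1..b+1} \<Longrightarrow> g i \<in> G"
  unfolding Gb_def by (rule generate.incl) blast

lemma free: "freely_independent {1..b} g"
  using hol by (simp add: holonomy_generators_def)

lemma h_0: "h 0 = matrix_inv (g 1)"
  by (simp add: hcurve_def)

lemma h_Suc: "h (Suc j) = matrix_inv (g (j + 2)) ** h j"
proof -
  have "[1..<Suc j + 2] = [1..<j + 2] @ [j + 2]" by simp
  then show ?thesis unfolding hcurve_def by simp
qed

text \<open>The inverse of \<open>h j\<close> is \<open>g 1 ** \<dots> ** g (j + 1)\<close>, so this is the defining relation of the group.\<close>

lemma h_last: "h (b - 1) = g (b + 1)"
proof -
  have inv: "mprod (map g [1..<j + 2]) ** h j = mat 1" if "j \<le> b - 1" for j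
    using that
  proof (induction j)
    case 0
    then show ?case using matrix_inv_cancel(1)[OF g_carrier[of 1]] b by (simp add: h_0)
  next
    case (Suc j)
    have up: "[1..<Suc j + 2] = [1..<j + 2] @ [j + 2]" by simp
    have "g (j + 2) \<in> carrier SO21" using Suc.prems by (intro g_carrier) auto
    note c = matrix_inv_cancel(1)[OF this]
    have "mprod (map g [1..<Suc j + 2]) ** h (Suc j) =
        mprod (map g [1..<j + 2]) ** (g (j + 2) ** matrix_inv (g (j + 2))) ** h j"
      unfolding up h_Suc by (simp add: mprod_append matrix_mul_assoc)
    also have "\<dots> = mat 1" unfolding c using Suc by simp
    finally show ?case .
  qed
  let ?q = "mprod (map g [1..<b - 1 + 2])"
  have "h (b - 1) ** ?q = mat 1" using inv[of "b - 1"] matrix_left_right_inverse by blast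
  moreover have "[1..<b + 2] = [1..<b - 1 + 2] @ [b + 1]" using b by simp
  then have "?q ** g (b + 1) = mat 1"
    using hol by (simp add: holonomy_generators_def mprod_append del: upt_Suc)
  ultimately show ?thesis by (metis matrix_mul_assoc matrix_mul_lid matrix_mul_rid)
qed

lemma Gb_eq: "G = generate SO21 (g ` {1..b})"
proof
  note H = group.generate_is_subgroup[OF group_SO21 basis_carrier]
  have hin: "h j \<in> generate SO21 (g ` {1..b})" if "j \<le> b - 1" for j
    using that
  proof (induction j)
    case 0
    have "g 1 \<in> generate SO21 (g ` {1..b})" by (rule generate.incl) (use b in auto)
    then show ?case unfolding h_0 by (rule subgroup_SO21D(4)[OF H])
  next
    case (Suc j)
    have "g (j + 2) \<in> generate SO21 (g ` {1..b})" by (rule generate.incl) (use Suc.prems in auto)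
    then show ?case unfolding h_Suc using Suc by (intro subgroup_SO21D(3,4)[OF H]) auto
  qed
  have "g i \<in> generate SO21 (g ` {1..b})" if "i \<in> {1..b+1}" for i
    using hin[of "b - 1"] that b unfolding h_last by (cases "i = b + 1") (auto intro: generate.incl)
  then show "G \<subseteq> generate SO21 (g ` {1..b})"
    unfolding Gb_def by (intro group.generate_subgroup_incl[OF group_SO21 _ H]) blast
  show "generate SO21 (g ` {1..b}) \<subseteq> G"
    unfolding Gb_def by (intro group.mono_generate[OF group_SO21]) auto
qed

lemma h_in_G: "j \<le> b - 1 \<Longrightarrow> h j \<in> G"
proof (induction j)
  case 0
  then show ?case unfolding h_0 using g_in_G[of 1] G b by auto
next
  case (Suc j)
  then show ?case unfolding h_Suc using g_in_G[of "j + 2"] by (intro G) auto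
qed

lemma free_word_hyperbolic:
  assumes w: "w \<noteq> []" "fst ` set w \<subseteq> {1..b}" "Defs.reduced (w @ w)"
  shows "hyperbolic (word_val g w)"
proof -
  obtain c r p where cp: "disjoint_caps (b+1) c r" "orbit_homeo G (holed_sphere (b+1) c r) p"
    and per: "\<forall>A\<in>G. \<forall>i\<in>{1..b+1}. A \<noteq> mat 1 \<and> homotopic_into_boundary p (c i) (r i) A \<longrightarrow> hyperbolic A"
    using hol unfolding holonomy_generators_def by blast
  have disc: "discrete G" using hol by (simp add: holonomy_generators_def)
  have gw: "word_val g w \<in> G"
    unfolding Gb_eq generate_words[OF basis_carrier] using w(2) by blast
  show ?thesis
    by (rule infinite_order_hyperbolic[OF subgroup_G disc cp _ gw free_infinite_order[OF free w]])
       (use per in blast)+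
qed

lemma word_val_h: "word_val g (map (\<lambda>i. (i, False)) (rev [1..<j + 2])) = h j"
  by (simp add: word_val_def hcurve_def o_def)

lemma h_hyperbolic:
  assumes "j \<le> b - 1"
  shows "hyperbolic (h j)"
proof -
  define w where "w = map (\<lambda>i. (i, False)) (rev [1..<j + 2])"
  have "hyperbolic (word_val g w)"
  proof (rule free_word_hyperbolic)
    show "w \<noteq> []" by (simp add: w_def)
    show "fst ` set w \<subseteq> {1..b}" using assms b by (auto simp: w_def)
    show "Defs.reduced (w @ w)" by (rule reduced_constant_sign[of _ False]) (auto simp: w_def)
  qed
  then show ?thesis unfolding w_def word_val_h .
qed

lemma g_hyperbolic:
  assumes "i \<in> {1..b+1}"
  shows "hyperbolic (g i)"
proof (cases "i = b + 1")
  case True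
  then show ?thesis using h_hyperbolic[of "b - 1"] h_last by simp
next
  case False
  have "hyperbolic (word_val g [(i, True)])"
  proof (rule free_word_hyperbolic)
    show "Defs.reduced ([(i, True)] @ [(i, True)])" by (rule reduced_constant_sign[of _ True]) auto
  qed (use assms False in auto)
  then show ?thesis by (simp add: letter_val_def)
qed

(* Keeps the indices 1 and j + 2 in this form, in which the facts about g 1 and g (j + 2) are stated. *)
declare add_2_eq_Suc' [simp del] One_nat_def [simp del]

text \<open>A common null eigenvector would be fixed by the commutator, which is hyperbolic since it is
  given by a cyclically reduced word; but hyperbolic elements fix no null vector.\<close>

lemma no_common_null_eigenvector:
  assumes j: "j \<le> b - 2" and n: "lor n n = 0" "h j *v n = \<mu> *\<^sub>R n" "g (j + 2) *v n = \<nu> *\<^sub>R n"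
  shows "n = 0"
proof (rule ccontr)
  assume n0: "n \<noteq> 0"
  define w1 w2 where "w1 = map (\<lambda>i. (i, False)) (rev [1..<j + 2])"
    and "w2 = map (\<lambda>i. (i, True)) [1..<j + 2]"
  define w where "w = w1 @ [(j + 2, True)] @ w2 @ [(j + 2, False)]"
  have ne: "w1 \<noteq> []" "w2 \<noteq> []" by (simp_all add: w1_def w2_def)
  have red: "Defs.reduced w1" "Defs.reduced w2"
    by (rule reduced_constant_sign[of _ False], auto simp: w1_def)
       (rule reduced_constant_sign[of _ True], auto simp: w2_def)
  have ends: "hd w1 = (j + 1, False)" "last w1 = (1, False)" "hd w2 = (1, True)" "last w2 = (j + 1, True)"
    by (simp_all add: w1_def w2_def hd_map last_map hd_rev last_rev del: upt_Suc)
  have "Defs.reduced (w @ w)"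
    using red ne ends unfolding Defs.reduced_def w_def by (auto simp: successively_append_iff successively_Cons)
  moreover have "fst ` set w \<subseteq> {1..b}" using j b by (auto simp: w_def w1_def w2_def)
  ultimately have hyp: "hyperbolic (word_val g w)" by (intro free_word_hyperbolic) (auto simp: w_def)
  \<comment> \<open>\<open>w\<close> spells the commutator of \<open>h j\<close> and \<open>g (j + 2)\<close>.\<close>
  have w1: "fst ` set w1 \<subseteq> {1..b}" "word_val g w1 = h j"
    using j b word_val_h[of j] by (auto simp: w1_def simp del: upt_Suc)
  have "inverse_word w1 = w2"
    by (simp add: inverse_word_def w1_def w2_def rev_map o_def)
  then have inv: "word_val g w2 ** h j = mat 1"
    using word_val_inverse_word[OF basis_carrier w1(1)] by (simp only: w1(2))
  have w: "word_val g w = h j ** (g (j + 2) ** (word_val g w2 ** matrix_inv (g (j + 2))))"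
    by (simp add: w_def w1(2) letter_val_def)
  have gj: "g (j + 2) \<in> carrier SO21" using j b by (intro g_carrier) auto
  have hj: "h j \<in> carrier SO21" using h_hyperbolic[of j] hyperbolic_eig(1) j by simp
  have gh: "g (j + 2) *v (h j *v n) = (\<mu> * \<nu>) *\<^sub>R n" by (simp add: n matrix_vector_mult_scaleR)
  have "word_val g w *v (g (j + 2) *v (h j *v n)) = h j *v (g (j + 2) *v ((word_val g w2 ** h j) *v n))"
    by (simp add: w matrix_inv_cancel[OF gj] flip: matrix_vector_mul_assoc)
  also have "\<dots> = (\<mu> * \<nu>) *\<^sub>R n" by (simp add: inv n matrix_vector_mult_scaleR mult.commute)
  finally have fixed: "word_val g w *v ((\<mu> * \<nu>) *\<^sub>R n) = (\<mu> * \<nu>) *\<^sub>R n" by (simp only: gh)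
  have "(\<mu> * \<nu>) *\<^sub>R n = 0"
    by (rule hyperbolic_no_fixed_null[OF hyp _ fixed]) (simp add: lor_bilinear n)
  then have "g (j + 2) *v (h j *v n) = 0" by (simp only: gh)
  then have "matrix_inv (h j) *v (matrix_inv (g (j + 2)) *v (g (j + 2) *v (h j *v n))) = 0"
    by simp
  then have "n = 0" by (simp only: matrix_inv_cancel(4)[OF gj] matrix_inv_cancel(4)[OF hj])
  then show False using n0 by simp
qed

text \<open>If the product vanished, \<open>Xp (g (j + 2))\<close> would be an eigenvector of \<open>h (j + 1)\<close>, hence of
  \<open>h j = g (j + 2) ** h (j + 1)\<close>.\<close>

lemma Xp_nondegenerate_next:
  assumes j: "j \<le> b - 2"
  shows "lor (Xp (g (j + 2))) (g (j + 2) *v X0 (h (Suc j))) \<noteq> 0"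
proof
  let ?g = "g (j + 2)"
  have gh: "hyperbolic ?g" using j b by (intro g_hyperbolic) auto
  note X = hyperbolic_Xm_Xp[OF gh]
  note gc = hyperbolic_eig[OF gh]
  have Sj: "Suc j \<le> b - 1" using j b by simp
  assume "lor (Xp ?g) (?g *v X0 (h (Suc j))) = 0"
  then have "(1 / eig ?g) * lor (Xp ?g) (?g *v X0 (h (Suc j))) = 0" by simp
  then have "lor (?g *v Xp ?g) (?g *v X0 (h (Suc j))) = 0" by (simp only: X lor_scale_left)
  then have "lor (Xp ?g) (X0 (h (Suc j))) = 0" by (simp only: SO21_lor[OF gc(1)])
  then obtain \<mu> where \<mu>: "h (Suc j) *v Xp ?g = \<mu> *\<^sub>R Xp ?g"
    using hyperbolic_orthogonal_null_eigenvector[OF h_hyperbolic[OF Sj] X(5)] by blast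
  have "h j *v Xp ?g = ?g *v (h (Suc j) *v Xp ?g)"
    unfolding h_Suc by (simp add: matrix_inv_cancel[OF gc(1)] flip: matrix_vector_mul_assoc)
  also have "\<dots> = (\<mu> * (1 / eig ?g)) *\<^sub>R Xp ?g" by (simp add: \<mu> X matrix_vector_mult_scaleR)
  finally have "Xp ?g = 0" using no_common_null_eigenvector[OF j X(5) _ X(4)] by blast
  then show False using X(6) by simp
qed

lemma X0_h_nondegenerate:
  assumes j: "j \<le> b - 2"
  shows "lor (X0 (h j)) (Xp (g (j + 2))) \<noteq> 0"
proof
  let ?g = "g (j + 2)"
  have gh: "hyperbolic ?g" using j b by (intro g_hyperbolic) auto
  note X = hyperbolic_Xm_Xp[OF gh]
  have hj: "j \<le> b - 1" using j by simp
  assume "lor (X0 (h j)) (Xp ?g) = 0"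
  then obtain \<mu> where "h j *v Xp ?g = \<mu> *\<^sub>R Xp ?g"
    using hyperbolic_orthogonal_null_eigenvector[OF h_hyperbolic X(5)] hj lor_commute by metis
  then have "Xp ?g = 0" using no_common_null_eigenvector[OF j X(5) _ X(4)] by blast
  then show False using X(6) by simp
qed

lemma X0_1_nondegenerate: "lor (X0 (g 1)) (Xp (g 2)) \<noteq> 0"
proof
  have gh: "hyperbolic (g 2)" "hyperbolic (g 1)" using b by (auto intro!: g_hyperbolic)
  note X = hyperbolic_Xm_Xp[OF gh(1)] and g1 = hyperbolic_eig(1)[OF gh(2)]
  assume "lor (X0 (g 1)) (Xp (g 2)) = 0"
  then obtain \<mu> where \<mu>: "g 1 *v Xp (g 2) = \<mu> *\<^sub>R Xp (g 2)"
    using hyperbolic_orthogonal_null_eigenvector[OF gh(2) X(5)] lor_commute by metis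
  have id: "Xp (g 2) = \<mu> *\<^sub>R (h 0 *v Xp (g 2))"
    using matrix_inv_cancel(4)[OF g1, of "Xp (g 2)"] by (simp add: h_0 \<mu> matrix_vector_mult_scaleR)
  have "Xp (g 2) \<noteq> 0" using X(6) by auto
  then have "\<mu> \<noteq> 0" using id by auto
  then have "h 0 *v Xp (g 2) = (1 / \<mu>) *\<^sub>R Xp (g 2)" by (subst id) simp
  then have "Xp (g 2) = 0"
    using no_common_null_eigenvector[of 0 "Xp (g 2)" "1 / \<mu>" "1 / eig (g 2)"] X(4,5) by simp
  then show False using X(6) by simp
qed

lemma Z1_h_0: "u \<in> Z1 G \<Longrightarrow> u (h 0) = - (matrix_inv (g 1) *v u (g 1))"
  unfolding h_0 using Z1_inv[OF subgroup_G] g_in_G by simp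

lemma Z1_h_Suc:
  assumes u: "u \<in> Z1 G" and j: "j \<le> b - 2"
  shows "u (h (Suc j)) = matrix_inv (g (j + 2)) *v (u (h j) - u (g (j + 2)))"
proof -
  have gj: "g (j + 2) \<in> G" using j b by (intro g_in_G) auto
  have hj: "h j \<in> G" using j by (intro h_in_G) auto
  show ?thesis
    unfolding h_Suc Z1_mult[OF u G(4)[OF gj] hj] Z1_inv[OF subgroup_G u gj]
    by (simp add: matrix_vector_mult_diff_distrib)
qed

lemma margulis_h_Suc:
  assumes u: "u \<in> Z1 G" and j: "j \<le> b - 2"
  shows "margulis u (h (Suc j)) = lor (u (h j) - u (g (j + 2))) (g (j + 2) *v X0 (h (Suc j)))"
proof -
  have gj: "g (j + 2) \<in> carrier SO21" using j b by (intro g_carrier) auto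
  show ?thesis unfolding margulis_def Z1_h_Suc[OF u j] by (rule lor_matrix_inv[OF gj])
qed

lemma Z1_eqI:
  assumes u: "u \<in> Z1 G" "w \<in> Z1 G" and eq: "\<And>i. i \<in> {1..b} \<Longrightarrow> u (g i) = w (g i)"
  shows "u = w"
proof
  fix A
  show "u A = w A"
  proof (cases "A \<in> G")
    case True
    show ?thesis
      by (rule Z1_eq_on_generate[OF subgroup_G u, of "g ` {1..b}"])
         (use True g_in_G eq in \<open>auto simp flip: Gb_eq\<close>)
  next
    case False
    then show ?thesis using u by (simp add: Z1_def)
  qed
qed

lemma Z1_exists: "\<exists>u\<in>Z1 G. \<forall>i\<in>{1..b}. u (g i) = v i"
  by (rule cocycle_exists[OF basis_carrier free Gb_eq])

text \<open>The components along \<open>Xm\<close> and \<open>Xp\<close> are read off by pairing with the other of the two null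
  vectors, so this is the normalisation of \<open>u0\<close> without its coefficients.\<close>

definition normalized :: "(real^3^3 \<Rightarrow> real^3) \<Rightarrow> bool" where
  "normalized u \<longleftrightarrow> lor (u (g 1)) (Xp (g 1)) = 0 \<and> lor (u (g 1)) (Xm (g 1)) = 0 \<and>
     (\<forall>i\<in>{2..b}. lor (u (g i)) (Xp (g i)) = 0)"

text \<open>By induction on \<open>j\<close>, \<open>u\<close> vanishes on \<open>g 1, \<dots>, g (j + 1)\<close> and \<open>h j\<close>: the remaining coefficient of
  \<open>u (g (j + 2))\<close> is detected by the Margulis invariant of \<open>h (j + 1)\<close>.\<close>

lemma normalized_zero:
  assumes u: "u \<in> Z1 G" "normalized u" and mg: "\<And>i. i \<in> {1..b+1} \<Longrightarrow> margulis u (g i) = 0"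
    and mh: "\<And>j. j \<in> {1..b-2} \<Longrightarrow> margulis u (h j) = 0"
  shows "u = (\<lambda>A. 0)"
proof -
  have mh': "margulis u (h j) = 0" if "j \<in> {1..b-1}" for j
  proof (cases "j = b - 1")
    case True
    then show ?thesis using mg[of "b + 1"] h_last by simp
  next
    case False
    then have "j \<in> {1..b-2}" using that by auto
    then show ?thesis by (rule mh)
  qed
  have "(\<forall>i\<in>{1..j+1}. u (g i) = 0) \<and> u (h j) = 0" if "j \<le> b - 1" for j
    using that
  proof (induction j)
    case 0
    have "u (g 1) = 0"
      using hyperbolic_expand[OF g_hyperbolic[of 1], of "u (g 1)"] u(2) mg[of 1]
      by (simp add: normalized_def margulis_def)
    then show ?case using Z1_h_0[OF u(1)] by simp
  next
    case (Suc j)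
    let ?g = "g (j + 2)"
    have j: "j \<le> b - 2" and i: "j + 2 \<in> {2..b}" "j + 2 \<in> {1..b+1}" using Suc.prems b by auto
    define c where "c = lor (u ?g) (Xm ?g) / lor (Xm ?g) (Xp ?g)"
    have ug: "u ?g = c *\<^sub>R Xp ?g"
      using hyperbolic_expand[OF g_hyperbolic[OF i(2)], of "u ?g"] u(2) mg[OF i(2)] i(1)
      by (simp add: normalized_def margulis_def c_def)
    have "0 = lor (u (h j) - u ?g) (?g *v X0 (h (Suc j)))"
      using mh'[of "Suc j"] margulis_h_Suc[OF u(1) j] Suc.prems by simp
    also have "\<dots> = - c * lor (Xp ?g) (?g *v X0 (h (Suc j)))"
      using Suc by (simp add: ug lor_bilinear)
    finally have "c = 0" using Xp_nondegenerate_next[OF j] by simp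
    then have ug0: "u ?g = 0" using ug by simp
    then have "u (h (Suc j)) = 0" using Z1_h_Suc[OF u(1) j] Suc by simp
    moreover have "{1..Suc j + 1} = insert (j + 2) {1..j + 1}" by auto
    ultimately show ?case using Suc ug0 by simp
  qed
  from this[of "b - 1"] show ?thesis
    using b by (intro Z1_eqI[OF u(1) Z1_zero]) auto
qed

text \<open>The free coefficient of \<open>u (g (j + 2))\<close> along the expanding direction is used to prescribe the
  Margulis invariant of \<open>h (j + 1)\<close>; for the last \<open>j\<close> this is the boundary curve \<open>g (b + 1)\<close>.\<close>

lemma normalized_exists:
  "\<exists>u\<in>Z1 G. normalized u \<and> (\<forall>i\<in>{1..b+1}. margulis u (g i) = \<alpha> i) \<and>
    (\<forall>j\<in>{1..b-2}. margulis u (h j) = \<beta> j)"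
proof -
  \<comment> \<open>\<open>H j\<close> is the value that \<open>u (h j)\<close> will take, \<open>V j (H j)\<close> that of \<open>u (g (j + 2))\<close>, and \<open>B j\<close> the prescribed
    invariant of \<open>h j\<close>.\<close>
  define B where "B j = (if j = b - 1 then \<alpha> (b + 1) else \<beta> j)" for j
  define Y where "Y j = g (j + 2) *v X0 (h (Suc j))" for j
  define V where "V j H = \<alpha> (j + 2) *\<^sub>R X0 (g (j + 2)) +
    ((lor (H - \<alpha> (j + 2) *\<^sub>R X0 (g (j + 2))) (Y j) - B (Suc j)) / lor (Xp (g (j + 2))) (Y j)) *\<^sub>R Xp (g (j + 2))"
    for j H
  define H where "H = rec_nat (- (matrix_inv (g 1) *v (\<alpha> 1 *\<^sub>R X0 (g 1))))
    (\<lambda>j x. matrix_inv (g (j + 2)) *v (x - V j x))"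
  have H: "H 0 = - (matrix_inv (g 1) *v (\<alpha> 1 *\<^sub>R X0 (g 1)))"
    "H (Suc j) = matrix_inv (g (j + 2)) *v (H j - V j (H j))" for j
    by (simp_all add: H_def)
  obtain u where u: "u \<in> Z1 G"
    and ug: "\<And>i. i \<in> {1..b} \<Longrightarrow> u (g i) = (if i = 1 then \<alpha> 1 *\<^sub>R X0 (g 1) else V (i - 2) (H (i - 2)))"
    using Z1_exists[of "\<lambda>i. if i = 1 then \<alpha> 1 *\<^sub>R X0 (g 1) else V (i - 2) (H (i - 2))"] by blast
  have u1: "u (g 1) = \<alpha> 1 *\<^sub>R X0 (g 1)" using ug[of 1] b by simp
  have uV: "u (g (j + 2)) = V j (H j)" if "j \<le> b - 2" for j using ug[of "j + 2"] that b by simp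
  have uh: "u (h j) = H j" if "j \<le> b - 1" for j
    using that
  proof (induction j)
    case 0
    then show ?case by (simp add: Z1_h_0[OF u] H u1)
  next
    case (Suc j)
    then have "j \<le> b - 2" by simp
    then show ?case using Suc by (simp add: Z1_h_Suc[OF u] H uV)
  qed
  have mh: "margulis u (h (Suc j)) = B (Suc j)" if j: "j \<le> b - 2" for j
  proof -
    have "margulis u (h (Suc j)) = lor (H j - V j (H j)) (Y j)"
      unfolding margulis_h_Suc[OF u j] Y_def[symmetric] using j by (simp add: uh uV)
    also have "\<dots> = B (Suc j)"
      using Xp_nondegenerate_next[OF j] unfolding V_def Y_def[symmetric]
      by (simp add: lor_bilinear)
    finally show ?thesis .
  qed
  have X: "lor (X0 (g i)) (X0 (g i)) = 1" "lor (X0 (g i)) (Xm (g i)) = 0" "lor (X0 (g i)) (Xp (g i)) = 0"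
    "lor (Xp (g i)) (Xp (g i)) = 0" "lor (Xp (g i)) (X0 (g i)) = 0" if "i \<in> {1..b+1}" for i
    using hyperbolic_X0[OF g_hyperbolic[OF that]] hyperbolic_Xm_Xp[OF g_hyperbolic[OF that]]
    by (simp_all add: lor_commute)
  have split: "\<exists>j\<le>b-2. i = j + 2" if "i \<in> {2..b}" for i
    using that by (intro exI[of _ "i - 2"]) auto
  have "normalized u"
    unfolding normalized_def
  proof (intro conjI ballI)
    show "lor (u (g 1)) (Xp (g 1)) = 0" "lor (u (g 1)) (Xm (g 1)) = 0"
      using X[of 1] b by (simp_all add: u1 lor_bilinear)
    fix i assume "i \<in> {2..b}"
    then obtain j where j: "j \<le> b - 2" "i = j + 2" using split by blast
    then have "i \<in> {1..b+1}" using b by simp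
    from X[OF this] show "lor (u (g i)) (Xp (g i)) = 0"
      unfolding j(2) uV[OF j(1)] V_def by (simp add: lor_bilinear)
  qed
  moreover have "margulis u (g i) = \<alpha> i" if i: "i \<in> {1..b+1}" for i
  proof -
    consider "i = 1" | "i \<in> {2..b}" | "i = b + 1" using i by force
    then show ?thesis
    proof cases
      case 1
      then show ?thesis using X[of 1] b by (simp add: margulis_def u1 lor_bilinear)
    next
      case 2
      then obtain j where j: "j \<le> b - 2" "i = j + 2" using split by blast
      from X[OF i] show ?thesis
        unfolding j(2) margulis_def uV[OF j(1)] V_def by (simp add: lor_bilinear)
    next
      case 3
      have "Suc (b - 2) = b - 1" using b by simp
      then show ?thesis using mh[of "b - 2"] h_last 3 by (simp add: B_def)
    qed
  qed
  moreover have "margulis u (h j) = \<beta> j" if "j \<in> {1..b-2}" for j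
  proof -
    have "Suc (j - 1) = j" "j - 1 \<le> b - 2" "j \<noteq> b - 1" using that b by auto
    then show ?thesis using mh[of "j - 1"] by (simp add: B_def)
  qed
  ultimately show ?thesis using u by blast
qed

text \<open>The coefficients in the eigenframe of \<open>g i\<close> are read off by pairing with the frame.\<close>

lemma u0_characterization:
  assumes u: "u \<in> Z1 G" and mg: "\<forall>i\<in>{1..b+1}. margulis u (g i) = \<alpha> i"
  shows "(\<exists>cm cp. (\<forall>i\<in>{1..b+1}. u (g i) =
                 \<alpha> i *\<^sub>R X0 (g i) + cm i *\<^sub>R Xm (g i) + cp i *\<^sub>R Xp (g i)) \<and>
        cm 1 = 0 \<and> cp 1 = 0 \<and> (\<forall>i\<in>{2..b}. cm i = 0)) \<longleftrightarrow> normalized u"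
proof
  have X: "lor (X0 (g i)) (Xm (g i)) = 0" "lor (X0 (g i)) (Xp (g i)) = 0"
    "lor (Xp (g i)) (Xp (g i)) = 0" "lor (Xm (g i)) (Xm (g i)) = 0" if "i \<in> {1..b+1}" for i
    using hyperbolic_X0[OF g_hyperbolic[OF that]] hyperbolic_Xm_Xp[OF g_hyperbolic[OF that]] by simp_all
  assume "\<exists>cm cp. (\<forall>i\<in>{1..b+1}. u (g i) =
                 \<alpha> i *\<^sub>R X0 (g i) + cm i *\<^sub>R Xm (g i) + cp i *\<^sub>R Xp (g i)) \<and>
        cm 1 = 0 \<and> cp 1 = 0 \<and> (\<forall>i\<in>{2..b}. cm i = 0)"
  then obtain cm cp where
    c: "\<And>i. i \<in> {1..b+1} \<Longrightarrow> u (g i) = \<alpha> i *\<^sub>R X0 (g i) + cm i *\<^sub>R Xm (g i) + cp i *\<^sub>R Xp (g i)"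
    "cm 1 = 0" "cp 1 = 0" "\<And>i. i \<in> {2..b} \<Longrightarrow> cm i = 0" by blast
  show "normalized u"
    unfolding normalized_def using c(2,3) c(1)[of 1] X[of 1]
    by (auto simp: c(1,4) X lor_bilinear)
next
  assume n: "normalized u"
  define cm where "cm i = lor (u (g i)) (Xp (g i)) / lor (Xm (g i)) (Xp (g i))" for i
  define cp where "cp i = lor (u (g i)) (Xm (g i)) / lor (Xm (g i)) (Xp (g i))" for i
  have "u (g i) = \<alpha> i *\<^sub>R X0 (g i) + cm i *\<^sub>R Xm (g i) + cp i *\<^sub>R Xp (g i)" if "i \<in> {1..b+1}" for i
    using hyperbolic_expand[OF g_hyperbolic[OF that], of "u (g i)"] mg that
    by (simp add: cm_def cp_def margulis_def)
  moreover have "cm 1 = 0" "cp 1 = 0" "\<forall>i\<in>{2..b}. cm i = 0"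
    using n by (auto simp: cm_def cp_def normalized_def)
  ultimately show "\<exists>cm cp. (\<forall>i\<in>{1..b+1}. u (g i) =
                 \<alpha> i *\<^sub>R X0 (g i) + cm i *\<^sub>R Xm (g i) + cp i *\<^sub>R Xp (g i)) \<and>
        cm 1 = 0 \<and> cp 1 = 0 \<and> (\<forall>i\<in>{2..b}. cm i = 0)" by blast
qed

lemma normalized_unique:
  assumes u: "u \<in> Z1 G" "normalized u" and w: "w \<in> Z1 G" "normalized w"
    and mg: "\<And>i. i \<in> {1..b+1} \<Longrightarrow> margulis u (g i) = margulis w (g i)"
    and mh: "\<And>j. j \<in> {1..b-2} \<Longrightarrow> margulis u (h j) = margulis w (h j)"
  shows "u = w"
proof -
  have "(\<lambda>A. u A - w A) = (\<lambda>A. 0)"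
    by (rule normalized_zero[OF Z1_diff[OF u(1) w(1)]])
       (use u w mg mh in \<open>auto simp: normalized_def lor_bilinear margulis_diff\<close>)
  then show ?thesis by (simp add: fun_eq_iff)
qed

lemma u0_eqI:
  assumes u: "u \<in> Z1 G" "normalized u" and mg: "\<And>i. i \<in> {1..b+1} \<Longrightarrow> margulis u (g i) = \<alpha> i"
    and mh: "\<And>j. j \<in> {1..b-2} \<Longrightarrow> margulis u (h j) = \<beta> j"
  shows "u0 b g \<alpha> \<beta> = u"
  unfolding u0_def
proof (rule the_equality, goal_cases)
  case 1
  show ?case using u0_characterization[of u \<alpha>] u mg mh by simp
next
  case (2 w)
  then have "normalized w" using u0_characterization[of w \<alpha>] by blast
  with 2 show ?case by (intro normalized_unique[OF _ _ u]) (auto simp: mg mh)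
qed

lemma u0:
  shows "u0 b g \<alpha> \<beta> \<in> Z1 G" "normalized (u0 b g \<alpha> \<beta>)"
    "i \<in> {1..b+1} \<Longrightarrow> margulis (u0 b g \<alpha> \<beta>) (g i) = \<alpha> i"
    "j \<in> {1..b-2} \<Longrightarrow> margulis (u0 b g \<alpha> \<beta>) (h j) = \<beta> j"
proof -
  obtain u where u: "u \<in> Z1 G" "normalized u" "\<forall>i\<in>{1..b+1}. margulis u (g i) = \<alpha> i"
    "\<forall>j\<in>{1..b-2}. margulis u (h j) = \<beta> j" using normalized_exists by blast
  then have "u0 b g \<alpha> \<beta> = u" by (intro u0_eqI) auto
  then show "u0 b g \<alpha> \<beta> \<in> Z1 G" "normalized (u0 b g \<alpha> \<beta>)"
    "i \<in> {1..b+1} \<Longrightarrow> margulis (u0 b g \<alpha> \<beta>) (g i) = \<alpha> i"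
    "j \<in> {1..b-2} \<Longrightarrow> margulis (u0 b g \<alpha> \<beta>) (h j) = \<beta> j" using u by auto
qed

lemma u0_add: "u0 b g (\<lambda>i. \<alpha> i + \<alpha>' i) (\<lambda>j. \<beta> j + \<beta>' j) = (\<lambda>A. u0 b g \<alpha> \<beta> A + u0 b g \<alpha>' \<beta>' A)"
  using u0(2)[of \<alpha> \<beta>] u0(2)[of \<alpha>' \<beta>']
  by (intro u0_eqI Z1_add u0(1)) (auto simp: margulis_add u0 normalized_def lor_bilinear)

lemma u0_scale: "u0 b g (\<lambda>i. a * \<alpha> i) (\<lambda>j. a * \<beta> j) = (\<lambda>A. a *\<^sub>R u0 b g \<alpha> \<beta> A)"
  using u0(2)[of \<alpha> \<beta>]
  by (intro u0_eqI Z1_scale u0(1)) (auto simp: margulis_scale u0 normalized_def lor_bilinear)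

lemma g_1_in_pants: "g 1 \<in> pants b g 1"
  unfolding pants_def by (rule generate.incl) simp

lemma g_in_pants: "j \<in> {1..b-1} \<Longrightarrow> g (j + 1) \<in> pants b g j"
  unfolding pants_def by (rule generate.incl) (use b in auto)

lemma pants_eqI:
  assumes j: "j \<in> {1..b-1}" and u: "u \<in> Z1 G" "w \<in> Z1 G"
    and g1: "j = 1 \<Longrightarrow> u (g 1) = w (g 1)" and gj: "u (g (j + 1)) = w (g (j + 1))"
    and h: "u (h (j - 1)) = w (h (j - 1))" "u (h j) = w (h j)"
    and A: "A \<in> pants b g j"
  shows "u A = w A"
proof -
  have e: "Suc (b - Suc 0) = b" "b - 1 - 1 = b - 2" using b by auto
  define S where "S = (if j = 1 then {g 1, g 2, h 1}
      else if j = b - 1 then {h (b - 2), g b, g (b + 1)} else {h (j - 1), g (j + 1), h j})"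
  show ?thesis
  proof (rule Z1_eq_on_generate[OF subgroup_G u])
    show "A \<in> generate SO21 S" using A by (simp add: pants_def S_def)
    show "S \<subseteq> G" using j b by (auto simp: S_def intro!: g_in_G h_in_G)
    show "u A = w A" if "A \<in> S" for A
      using that g1 gj h e h_last by (auto simp: S_def numeral_2_eq_2 split: if_splits)
  qed
qed

text \<open>At \<open>j = k\<close> both descriptions apply and agree, because \<open>h k\<close> fixes \<open>X0 (h k)\<close>.\<close>

lemma twist_values_on_h:
  assumes u: "u \<in> Z1 G" and k: "k \<in> {1..b-2}"
    and v0: "\<And>i. i \<in> {1..k+1} \<Longrightarrow> u (g i) = 0"
    and v1: "\<And>i. i \<in> {k+2..b} \<Longrightarrow> u (g i) = X0 (h k) - g i *v X0 (h k)"
  shows "j \<le> k \<Longrightarrow> u (h j) = 0"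
    and "k \<le> j \<Longrightarrow> j \<le> b - 1 \<Longrightarrow> u (h j) = X0 (h k) - h j *v X0 (h k)"
proof -
  show 0: "j \<le> k \<Longrightarrow> u (h j) = 0" for j
  proof (induction j)
    case 0
    then show ?case using v0[of 1] by (simp add: Z1_h_0[OF u])
  next
    case (Suc j)
    then show ?case using v0[of "j + 2"] k by (simp add: Z1_h_Suc[OF u])
  qed
  show "k \<le> j \<Longrightarrow> j \<le> b - 1 \<Longrightarrow> u (h j) = X0 (h k) - h j *v X0 (h k)"
  proof (induction j rule: dec_induct)
    case base
    then show ?case using 0[of k] hyperbolic_X0(1)[OF h_hyperbolic[of k]] by simp
  next
    case (step j)
    then have j: "j \<le> b - 2" and i: "j + 2 \<in> {k+2..b}" using b by auto
    have gc: "g (j + 2) \<in> carrier SO21" using i by (intro g_carrier) auto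
    show ?case
      unfolding Z1_h_Suc[OF u j] v1[OF i] using step
      by (simp add: h_Suc matrix_vector_mult_diff_distrib matrix_inv_cancel[OF gc, simplified]
        flip: matrix_vector_mul_assoc)
  qed
qed

text \<open>The cocycle with these values on the free basis has the defining property of the twist: each
  pair of pants is generated by boundary curves on which the values are known. Conversely
  each basis element lies in some pair of pants.\<close>

lemma AT:
  assumes k: "k \<in> {1..b-2}"
  shows "AT b g k \<in> Z1 G" "i \<in> {1..k+1} \<Longrightarrow> AT b g k (g i) = 0"
    "i \<in> {k+2..b} \<Longrightarrow> AT b g k (g i) = X0 (h k) - g i *v X0 (h k)"
proof -
  let ?Y = "X0 (h k)"
  let ?spec = "\<lambda>u. u \<in> Z1 G \<and> (\<forall>l\<in>{1..k}. \<forall>A\<in>pants b g l. u A = 0) \<and>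
     (\<forall>m\<in>{k+1..b-1}. \<forall>A\<in>pants b g m. u A = coboundary G ?Y A)"
  obtain u where u: "u \<in> Z1 G" and ug: "\<forall>i\<in>{1..b}. u (g i) = (if i \<le> k + 1 then 0 else ?Y - g i *v ?Y)"
    using Z1_exists[of "\<lambda>i. if i \<le> k + 1 then 0 else ?Y - g i *v ?Y"] by blast
  have v: "\<And>i. i \<in> {1..k+1} \<Longrightarrow> u (g i) = 0" "\<And>i. i \<in> {k+2..b} \<Longrightarrow> u (g i) = ?Y - g i *v ?Y"
    using ug k by auto
  have uh: "\<And>j. j \<le> k \<Longrightarrow> u (h j) = 0"
    "\<And>j. k \<le> j \<Longrightarrow> j \<le> b - 1 \<Longrightarrow> u (h j) = ?Y - h j *v ?Y"
    by (rule twist_values_on_h[OF u k]; use v in blast)+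
  have spec: "?spec u"
  proof (intro conjI ballI u)
    fix l A assume l: "l \<in> {1..k}" and A: "A \<in> pants b g l"
    show "u A = 0"
      by (rule pants_eqI[OF _ u Z1_zero _ _ _ _ A]) (use l k in \<open>auto simp: v uh\<close>)
  next
    fix m A assume m: "m \<in> {k+1..b-1}" and A: "A \<in> pants b g m"
    have m': "m + 1 \<in> {k+2..b}" using m b by auto
    have Gm: "g (m + 1) \<in> G" "h (m - 1) \<in> G" "h m \<in> G" using m by (auto intro!: g_in_G h_in_G)
    show "u A = coboundary G ?Y A"
      by (rule pants_eqI[OF _ u coboundary_Z1[OF subgroup_G] _ _ _ _ A])
         (use m k Gm v(2)[OF m'] uh(2)[of "m - 1"] uh(2)[of m] in \<open>auto simp: coboundary_def\<close>)
  qed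
  have vals: "w (g i) = (if i \<le> k + 1 then 0 else ?Y - g i *v ?Y)" if w: "?spec w" and i: "i \<in> {1..b}" for w i
  proof -
    have gG: "g i \<in> G" using i by (intro g_in_G) auto
    consider "i = 1" | "i \<noteq> 1" "i \<le> k + 1" | "k + 2 \<le> i" by force
    then show ?thesis
    proof cases
      case 1
      then show ?thesis using w g_1_in_pants k by auto
    next
      case 2
      then have l: "i - 1 \<in> {1..b-1}" "i - 1 \<in> {1..k}" "i - 1 + 1 = i" using i by auto
      have "g i \<in> pants b g (i - 1)" using g_in_pants[OF l(1)] by (simp only: l(3))
      then have "w (g i) = 0" using w l(2) by blast
      then show ?thesis using 2 by simp
    next
      case 3
      then have l: "i - 1 \<in> {1..b-1}" "i - 1 \<in> {k+1..b-1}" "i - 1 + 1 = i" using i by auto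
      have "g i \<in> pants b g (i - 1)" using g_in_pants[OF l(1)] by (simp only: l(3))
      with l(2) have "w (g i) = coboundary G ?Y (g i)" using w by blast
      then show ?thesis using 3 gG by (simp add: coboundary_def)
    qed
  qed
  have "AT b g k = u"
    unfolding AT_def
  proof (rule the_equality[where P = ?spec, OF spec])
    fix w assume "?spec w"
    then show "w = u" using vals ug by (intro Z1_eqI[OF _ u]) auto
  qed
  then show "AT b g k \<in> Z1 G" "i \<in> {1..k+1} \<Longrightarrow> AT b g k (g i) = 0"
    "i \<in> {k+2..b} \<Longrightarrow> AT b g k (g i) = ?Y - g i *v ?Y" using u v by auto
qed

lemma margulis_AT:
  assumes k: "k \<in> {1..b-2}"
  shows "j \<le> b - 1 \<Longrightarrow> margulis (AT b g k) (h j) = 0" "i \<in> {1..b+1} \<Longrightarrow> margulis (AT b g k) (g i) = 0"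
proof -
  note A = AT[OF k]
  have ATh: "\<And>j. j \<le> k \<Longrightarrow> AT b g k (h j) = 0"
    "\<And>j. k \<le> j \<Longrightarrow> j \<le> b - 1 \<Longrightarrow> AT b g k (h j) = X0 (h k) - h j *v X0 (h k)"
    by (rule twist_values_on_h[OF A(1) k]; use A in blast)+
  show h: "j \<le> b - 1 \<Longrightarrow> margulis (AT b g k) (h j) = 0" for j
    using ATh(1)[of j] ATh(2)[of j] margulis_coboundary[OF h_hyperbolic[of j]]
    by (cases "j \<le> k") (auto simp: margulis_def lor_bilinear)
  show "i \<in> {1..b+1} \<Longrightarrow> margulis (AT b g k) (g i) = 0"
  proof -
    assume i: "i \<in> {1..b+1}"
    then consider "i \<in> {1..k+1}" | "i \<in> {k+2..b}" | "i = b + 1" by force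
    then show ?thesis
    proof cases
      case 3
      then show ?thesis using h[of "b - 1"] h_last by simp
    qed (use A margulis_coboundary[OF g_hyperbolic[OF i]] in \<open>auto simp: margulis_def lor_bilinear\<close>)
  qed
qed

definition twist :: "(nat \<Rightarrow> real) \<Rightarrow> real^3^3 \<Rightarrow> real^3" where
  "twist t = (\<lambda>A. \<Sum>k=1..b-2. t k *\<^sub>R AT b g k A)"

lemma twist_Z1: "twist t \<in> Z1 G"
  unfolding twist_def by (intro Z1_sum Z1_scale AT)

lemma twist_g: "i \<in> {1, 2} \<Longrightarrow> twist t (g i) = 0"
  unfolding twist_def by (intro sum.neutral) (auto simp: AT(2))

lemma margulis_twist:
  "j \<le> b - 1 \<Longrightarrow> margulis (twist t) (h j) = 0" "i \<in> {1..b+1} \<Longrightarrow> margulis (twist t) (g i) = 0"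
  using margulis_AT by (simp_all add: margulis_def twist_def lor_sum_left lor_bilinear)

text \<open>The effect of the twist along \<open>h k\<close> on the normalisation condition at \<open>g (i + 2)\<close>.\<close>

definition twist_matrix :: "nat \<Rightarrow> nat \<Rightarrow> real" where
  "twist_matrix k i = lor (AT b g k (g (i + 2))) (Xp (g (i + 2)))"

lemma lor_twist: "lor (twist t (g (i + 2))) (Xp (g (i + 2))) = (\<Sum>k=1..b-2. t k * twist_matrix k i)"
  by (simp add: twist_def twist_matrix_def lor_sum_left lor_bilinear)

lemma twist_matrix_triangular:
  shows "k \<in> {1..b-2} \<Longrightarrow> twist_matrix k k \<noteq> 0"
    and "1 \<le> i \<Longrightarrow> i < k \<Longrightarrow> k \<le> b - 2 \<Longrightarrow> twist_matrix k i = 0"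
proof -
  assume k: "k \<in> {1..b-2}"
  then have i: "k + 2 \<in> {k+2..b}" "k + 2 \<in> {1..b+1}" by auto
  note hyp = g_hyperbolic[OF i(2)]
  have "twist_matrix k k = (1 - eig (g (k + 2))) * lor (X0 (h k)) (Xp (g (k + 2)))"
    unfolding twist_matrix_def AT(3)[OF k i(1)] by (rule lor_coboundary_Xp[OF hyp])
  then show "twist_matrix k k \<noteq> 0"
    using X0_h_nondegenerate[of k] hyperbolic_eig(3)[OF hyp] k by simp
next
  assume "1 \<le> i" "i < k" "k \<le> b - 2"
  then show "twist_matrix k i = 0"
    unfolding twist_matrix_def using AT(2)[of k "i + 2"] by (simp add: lor_bilinear)
qed

text \<open>Every cocycle can be normalised by a coboundary, for the first pair of pants, and affine
  twists, one for each of the remaining generators.\<close>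

lemma normalize:
  assumes u: "u \<in> Z1 G"
  shows "\<exists>v t. (\<forall>k. k \<notin> {1..b-2} \<longrightarrow> t k = 0) \<and> normalized (\<lambda>A. u A - coboundary G v A - twist t A)"
proof -
  have hyp: "hyperbolic (g 1)" "hyperbolic (g 2)" using b by (auto intro!: g_hyperbolic)
  have gG: "g i \<in> G" if "i \<in> {1..b}" for i using that by (intro g_in_G) auto
  note X1 = hyperbolic_X0[OF hyp(1)] hyperbolic_Xm_Xp[OF hyp(1)] and e1 = hyperbolic_eig[OF hyp(1)]
  define c where "c = lor (Xm (g 1)) (Xp (g 1))"
  define e where "e = eig (g 1)"
  define a1 where "a1 = lor (u (g 1)) (Xp (g 1)) / ((1 - e) * c)"
  define a2 where "a2 = lor (u (g 1)) (Xm (g 1)) / ((1 - 1 / e) * c)"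
  \<comment> \<open>\<open>v0\<close> normalises \<open>u\<close> on \<open>g 1\<close>; adding a multiple of \<open>X0 (g 1)\<close> preserves this and normalises \<open>u\<close> on \<open>g 2\<close>.\<close>
  define v0 where "v0 = a1 *\<^sub>R Xm (g 1) + a2 *\<^sub>R Xp (g 1)"
  define s where "s = (lor (u (g 2)) (Xp (g 2)) - lor (v0 - g 2 *v v0) (Xp (g 2))) /
    ((1 - eig (g 2)) * lor (X0 (g 1)) (Xp (g 2)))"
  define v where "v = v0 + s *\<^sub>R X0 (g 1)"
  have ne: "c \<noteq> 0" "1 - e \<noteq> 0" "1 - 1 / e \<noteq> 0" using X1 e1 by (auto simp: c_def e_def)
  have "lor v (Xp (g 1)) = a1 * c" "lor v (Xm (g 1)) = a2 * c"
    using X1 by (simp_all add: v_def v0_def lor_bilinear c_def lor_commute[of "Xp (g 1)" "Xm (g 1)"])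
  then have 1: "lor (v - g 1 *v v) (Xp (g 1)) = lor (u (g 1)) (Xp (g 1))"
    "lor (v - g 1 *v v) (Xm (g 1)) = lor (u (g 1)) (Xm (g 1))"
    unfolding lor_coboundary_Xp[OF hyp(1)] lor_coboundary_Xm[OF hyp(1)] e_def[symmetric]
    using ne by (simp_all add: a1_def a2_def)
  have "lor (v - g 2 *v v) (Xp (g 2)) = lor (v0 - g 2 *v v0) (Xp (g 2)) +
      s * ((1 - eig (g 2)) * lor (X0 (g 1)) (Xp (g 2)))"
    unfolding lor_coboundary_Xp[OF hyp(2)] v_def by (simp add: lor_bilinear algebra_simps)
  then have 2: "lor (v - g 2 *v v) (Xp (g 2)) = lor (u (g 2)) (Xp (g 2))"
    using X0_1_nondegenerate hyperbolic_eig(3)[OF hyp(2)] by (simp add: s_def)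
  define w where "w A = u A - coboundary G v A" for A
  have w: "lor (w (g 1)) (Xp (g 1)) = 0" "lor (w (g 1)) (Xm (g 1)) = 0" "lor (w (g 2)) (Xp (g 2)) = 0"
    using 1 2 gG[of 1] gG[of 2] b by (simp_all add: w_def coboundary_def lor_diff_left)
  have "\<exists>t. (\<forall>k. k \<notin> {1..b-2} \<longrightarrow> t k = 0) \<and>
      (\<forall>i\<in>{1..b-2}. (\<Sum>k=1..b-2. t k * twist_matrix k i) = lor (w (g (i + 2))) (Xp (g (i + 2))))"
    by (rule triangular_system_solvable) (fact twist_matrix_triangular)+
  then obtain t where t: "\<forall>k. k \<notin> {1..b-2} \<longrightarrow> t k = 0"
    "\<forall>i\<in>{1..b-2}. (\<Sum>k=1..b-2. t k * twist_matrix k i) = lor (w (g (i + 2))) (Xp (g (i + 2)))"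
    by blast
  have "normalized (\<lambda>A. w A - twist t A)"
    unfolding normalized_def
  proof (intro conjI ballI)
    fix i assume i: "i \<in> {2..b}"
    show "lor (w (g i) - twist t (g i)) (Xp (g i)) = 0"
    proof (cases "i = 2")
      case True
      then show ?thesis using w(3) twist_g[of 2] by simp
    next
      case False
      then have j: "i - 2 \<in> {1..b-2}" "i = (i - 2) + 2" using i by auto
      show ?thesis
        using t(2) lor_twist[of t "i - 2"] j by (simp add: lor_bilinear)
    qed
  qed (use w twist_g[of 1] in simp_all)
  then show ?thesis using t(1) unfolding w_def by blast
qed

text \<open>The twists vanish on \<open>g 1\<close> and \<open>g 2\<close>, and only the zero vector is fixed by both.\<close>

lemma coboundary_eq_twist:
  assumes eq: "twist t = coboundary G v"
  shows "i \<in> {1..b-2} \<Longrightarrow> t i = 0"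
proof -
  have hyp: "hyperbolic (g 1)" "hyperbolic (g 2)" using b by (auto intro!: g_hyperbolic)
  have fixed: "v - g i *v v = 0" if "i \<in> {1, 2}" for i
    using fun_cong[OF eq, of "g i"] twist_g[OF that] g_in_G[of i] that b by (auto simp: coboundary_def)
  have "lor v (Xp (g 1)) = 0" "lor v (Xm (g 1)) = 0"
    using lor_coboundary_Xp[OF hyp(1), of v] lor_coboundary_Xm[OF hyp(1), of v] fixed[of 1]
      hyperbolic_eig(2,3)[OF hyp(1)] by (simp_all add: lor_bilinear)
  then have v: "v = lor v (X0 (g 1)) *\<^sub>R X0 (g 1)" using hyperbolic_expand[OF hyp(1), of v] by simp
  have "lor v (Xp (g 2)) = 0"
    using lor_coboundary_Xp[OF hyp(2), of v] fixed[of 2] hyperbolic_eig(3)[OF hyp(2)]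
    by (simp add: lor_bilinear)
  moreover have "lor v (Xp (g 2)) = lor v (X0 (g 1)) * lor (X0 (g 1)) (Xp (g 2))"
    by (subst v) (rule lor_scale_left)
  ultimately have "v = 0" using X0_1_nondegenerate v by simp
  then have "twist t (g (i + 2)) = 0" for i using eq by (simp add: coboundary_def)
  then have "(\<Sum>k=1..b-2. t k * twist_matrix k i) = 0" for i
    by (simp flip: lor_twist add: lor_zero_left)
  then show "i \<in> {1..b-2} \<Longrightarrow> t i = 0"
    by (intro triangular_system_unique[of "b - 2" twist_matrix t i] twist_matrix_triangular)
qed

lemma Phi_eq: "Phi b g (\<alpha>, \<beta>, t) = (\<lambda>A. u0 b g \<alpha> \<beta> A + twist t A)"
  by (simp add: twist_def)

lemma Phi_Z1: "Phi b g x \<in> Z1 G"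
  by (cases x) (simp only: Phi_eq Z1_add u0 twist_Z1)

lemma Phi_add: "Phi b g (params_add x y) = (\<lambda>A. Phi b g x A + Phi b g y A)"
  by (cases x; cases y)
     (simp add: u0_add scaleR_add_left sum.distrib fun_eq_iff)

lemma Phi_scale: "Phi b g (params_scale a x) = (\<lambda>A. a *\<^sub>R Phi b g x A)"
  by (cases x) (simp add: u0_scale scaleR_add_right scaleR_sum_right fun_eq_iff)

lemma Phi_coboundary_zero:
  assumes eq: "Phi b g (\<alpha>, \<beta>, t) = coboundary G v"
  shows "i \<in> {1..b+1} \<Longrightarrow> \<alpha> i = 0" "j \<in> {1..b-2} \<Longrightarrow> \<beta> j = 0" "j \<in> {1..b-2} \<Longrightarrow> t j = 0"
proof -
  have cob: "margulis (coboundary G v) A = 0" if "hyperbolic A" "A \<in> G" for A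
    using margulis_coboundary[OF that(1)] that(2) by (simp add: margulis_def coboundary_def)
  have m: "margulis (coboundary G v) A = margulis (u0 b g \<alpha> \<beta>) A + margulis (twist t) A" for A
    unfolding eq[symmetric] Phi_eq by (rule margulis_add)
  show \<alpha>: "i \<in> {1..b+1} \<Longrightarrow> \<alpha> i = 0" for i
    using m[of "g i"] cob[OF g_hyperbolic g_in_G, of i] by (simp add: u0 margulis_twist)
  show \<beta>: "j \<in> {1..b-2} \<Longrightarrow> \<beta> j = 0" for j
  proof -
    assume j: "j \<in> {1..b-2}"
    then have j': "j \<le> b - 1" by auto
    show ?thesis
      using m[of "h j"] cob[OF h_hyperbolic[OF j'] h_in_G[OF j']] by (simp add: u0(4)[OF j] margulis_twist(1)[OF j'])
  qed
  have "u0 b g \<alpha> \<beta> = (\<lambda>A. 0)"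
    by (rule normalized_zero[OF u0(1,2)]) (simp_all add: u0 \<alpha> \<beta>)
  then have "twist t = coboundary G v" using eq unfolding Phi_eq by simp
  then show "j \<in> {1..b-2} \<Longrightarrow> t j = 0" by (rule coboundary_eq_twist)
qed

text \<open>Normalise \<open>u\<close>; the Margulis invariants, which do not change, identify the result as some \<open>u0\<close>.\<close>

lemma Phi_surjective:
  assumes u: "u \<in> Z1 G"
  shows "\<exists>x\<in>Db b. \<exists>v. (\<lambda>A. u A - Phi b g x A) = coboundary G v"
proof -
  obtain v t where t: "\<forall>k. k \<notin> {1..b-2} \<longrightarrow> t k = 0"
    and n: "normalized (\<lambda>A. u A - coboundary G v A - twist t A)" using normalize[OF u] by blast
  define \<alpha> where "\<alpha> i = (if i \<in> {1..b+1} then margulis u (g i) else 0)" for i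
  define \<beta> where "\<beta> j = (if j \<in> {1..b-2} then margulis u (h j) else 0)" for j
  have cob: "margulis (coboundary G v) A = 0" if "hyperbolic A" "A \<in> G" for A
    using margulis_coboundary[OF that(1)] that(2) by (simp add: margulis_def coboundary_def)
  have "u0 b g \<alpha> \<beta> = (\<lambda>A. u A - coboundary G v A - twist t A)"
  proof (rule u0_eqI[OF _ n])
    show "(\<lambda>A. u A - coboundary G v A - twist t A) \<in> Z1 G"
      by (intro Z1_diff u coboundary_Z1 subgroup_G twist_Z1)
    show "margulis (\<lambda>A. u A - coboundary G v A - twist t A) (g i) = \<alpha> i" if "i \<in> {1..b+1}" for i
      using cob[OF g_hyperbolic[OF that] g_in_G[OF that]] margulis_twist(2)[OF that, of t] that
      by (simp add: margulis_diff \<alpha>_def)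
    show "margulis (\<lambda>A. u A - coboundary G v A - twist t A) (h j) = \<beta> j" if "j \<in> {1..b-2}" for j
    proof -
      have j: "j \<le> b - 1" using that by auto
      show ?thesis
        using cob[OF h_hyperbolic[OF j] h_in_G[OF j]] margulis_twist(1)[OF j, of t] that
        by (simp add: margulis_diff \<beta>_def)
    qed
  qed
  then have "(\<lambda>A. u A - Phi b g (\<alpha>, \<beta>, t) A) = coboundary G v" unfolding Phi_eq by simp
  moreover have "(\<alpha>, \<beta>, t) \<in> Db b" using t by (auto simp: Db_def \<alpha>_def \<beta>_def)
  ultimately show ?thesis by blast
qed

lemma Phi_injective:
  assumes x: "x \<in> Db b" and y: "y \<in> Db b" and eq: "cohom_class G (Phi b g x) = cohom_class G (Phi b g y)"
  shows "x = y"
proof -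
  obtain \<alpha> \<beta> t \<alpha>' \<beta>' t' where xy: "x = (\<alpha>, \<beta>, t)" "y = (\<alpha>', \<beta>', t')" by (cases x; cases y) auto
  obtain v where v: "(\<lambda>A. Phi b g y A - Phi b g x A) = coboundary G v"
    using eq cohom_class_eq[OF subgroup_G Phi_Z1 Phi_Z1] by metis
  have "Phi b g (params_add y (params_scale (-1) x)) = coboundary G v"
    unfolding Phi_add Phi_scale v[symmetric] by simp
  note z = Phi_coboundary_zero[OF this[unfolded xy, simplified params_add.simps params_scale.simps]]
  have "\<alpha> i = \<alpha>' i" for i using x y z(1)[of i] by (cases "i \<in> {1..b+1}") (auto simp: Db_def xy)
  moreover have "\<beta> i = \<beta>' i" for i using x y z(2)[of i] by (cases "i \<in> {1..b-2}") (auto simp: Db_def xy)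
  moreover have "t i = t' i" for i using x y z(3)[of i] by (cases "i \<in> {1..b-2}") (auto simp: Db_def xy)
  ultimately show ?thesis by (auto simp: xy fun_eq_iff)
qed

lemma Phi_linear_iso: "linear_iso_to_H1 b G (\<lambda>x. cohom_class G (Phi b g x))"
  unfolding linear_iso_to_H1_def
proof (intro conjI ballI allI)
  show "bij_betw (\<lambda>x. cohom_class G (Phi b g x)) (Db b) (H1 G)"
    unfolding bij_betw_def
  proof
    show "inj_on (\<lambda>x. cohom_class G (Phi b g x)) (Db b)" by (intro inj_onI Phi_injective)
    have "cohom_class G u \<in> (\<lambda>x. cohom_class G (Phi b g x)) ` Db b" if u: "u \<in> Z1 G" for u
    proof -
      obtain x v where "x \<in> Db b" "(\<lambda>A. u A - Phi b g x A) = coboundary G v"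
        using Phi_surjective[OF u] by blast
      then show ?thesis using cohom_class_eq[OF subgroup_G Phi_Z1 u, of x] by blast
    qed
    then show "(\<lambda>x. cohom_class G (Phi b g x)) ` Db b = H1 G"
      unfolding H1_def using Phi_Z1 by blast
  qed
  show "cohom_class G (Phi b g (params_add x y)) =
      H1_add G (cohom_class G (Phi b g x)) (cohom_class G (Phi b g y))" for x y
    unfolding Phi_add H1_add_class[OF subgroup_G Phi_Z1 Phi_Z1] ..
  show "cohom_class G (Phi b g (params_scale a x)) = H1_scale G a (cohom_class G (Phi b g x))" for a x
    unfolding Phi_scale H1_scale_class[OF subgroup_G Phi_Z1] ..
qed

end

theorem theorem1p1:
  fixes b :: nat and g :: "nat \<Rightarrow> real^3^3"
  assumes "b \<ge> 3"
    and "holonomy_generators b g"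
  shows "Phi b g ` Db b \<subseteq> Z1 (Gb b g) \<and>
    linear_iso_to_H1 b (Gb b g) (\<lambda>x. cohom_class (Gb b g) (Phi b g x))"
proof -
  interpret holed_sphere_holonomy b g by unfold_locales (fact assms)+
  show ?thesis using Phi_Z1 Phi_linear_iso by blast
qed

end
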